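(* For every integer $n\ge 2$ and every continuous MHR distribution $F$, $$\mathrm{APX}(F,n)\le U_n:=\max_{q\in[1/e,1]}\min\left\{\frac{1}{1-(1-e^{-H_n+1})^n}+\frac{q(1-q)^{n-1}}{1-(1-q)^n},\ \frac{\int_0^q\frac{1-(1-z)^n}{z}\,dz}{1-(1-q)^n}\right\}.$$ In particular, the maximum of $U_n$ over all integers $n\ge 2$ is attained at $n=3$, and $U_3\le 1.354$ (so $\mathrm{APX}(F,3)\le 1.354$).
   Context: $F$ is the cdf of a continuous (absolutely continuous) probability distribution with pdf $f$, supported on an interval $D_F\subseteq[0,\infty)$. $F$ is MHR (monotone hazard rate) if $x\mapsto f(x)/(1-F(x))$ is nondecreasing on $D_F$; equivalently $\ln(1-F(x))$ is concave. For $n\ge2$ bidders with i.i.d. valuations from $F$, let $X_{n:n}$ be the maximum of $n$ i.i.d. draws from $F$ and $\phi(x)=x-\frac{1-F(x)}{f(x)}$ the virtual valuation. The optimal auction revenue is $\mathrm{Myerson}(F,n)=\mathbb{E}[\max\{0,\phi(X_{n:n})\}]$, the optimal anonymous pricing revenue is $\mathrm{Price}(F,n)=\sup_{p\in D_F}p\,(1-F(p)^n)$, and $\mathrm{APX}(F,n)=\mathrm{Myerson}(F,n)/\mathrm{Price}(F,n)$. $H_n=\sum_{i=1}^n 1/i$ is the $n$-th harmonic number. *)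

theory Defs
  imports "HOL-Probability.Probability"
begin

text \<open>A distribution is given by its cdf \<open>F\<close>, its pdf \<open>f\<close> and the interval \<open>D\<close> that supports it.\<close>

abbreviation distr_of_pdf :: "(real \<Rightarrow> real) \<Rightarrow> real measure" where
  "distr_of_pdf f \<equiv> density lborel (\<lambda>x. ennreal (f x))"

text \<open>\<open>D\<close> carries the full mass of the distribution; no convention is imposed on whether \<open>D\<close>
  contains its endpoints.\<close>

definition continuous_distribution ::
    "(real \<Rightarrow> real) \<Rightarrow> (real \<Rightarrow> real) \<Rightarrow> real set \<Rightarrow> bool" where
  "continuous_distribution F f D \<longleftrightarrow>
     f \<in> borel_measurable borel \<and> (\<forall>x. 0 \<le> f x) \<and>
     prob_space (distr_of_pdf f) \<and> F = cdf (distr_of_pdf f) \<and>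
     is_interval D \<and> D \<subseteq> {0..} \<and> (AE x in distr_of_pdf f. x \<in> D)"

text \<open>The hazard rate is meaningful only where \<open>F x < 1\<close>; a right endpoint of \<open>D\<close> belonging
  to \<open>D\<close> must be left out, since there division by zero would give the value \<open>0\<close> instead
  of infinity.\<close>

definition MHR :: "(real \<Rightarrow> real) \<Rightarrow> (real \<Rightarrow> real) \<Rightarrow> real set \<Rightarrow> bool" where
  "MHR F f D \<longleftrightarrow> mono_on {x \<in> D. F x < 1} (\<lambda>x. f x / (1 - F x))"

text \<open>Points with \<open>f x = 0\<close>, where the virtual valuation is a division by zero, have
  probability zero.\<close>

definition virtual_valuation :: "(real \<Rightarrow> real) \<Rightarrow> (real \<Rightarrow> real) \<Rightarrow> real \<Rightarrow> real" where
  "virtual_valuation F f x = x - (1 - F x) / f x"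

definition max_valuation :: "nat \<Rightarrow> (nat \<Rightarrow> real) \<Rightarrow> real" where
  "max_valuation n v = Max (v ` {..<n})"

text \<open>For \<open>n \<ge> 1\<close> and MHR distributions the expectation and the supremum below are finite,
  because such distributions have bounded support or exponentially decaying tails.\<close>

definition Myerson :: "(real \<Rightarrow> real) \<Rightarrow> (real \<Rightarrow> real) \<Rightarrow> nat \<Rightarrow> real" where
  "Myerson F f n =
     (LINT v | Pi\<^sub>M {..<n} (\<lambda>_. distr_of_pdf f).
        max 0 (virtual_valuation F f (max_valuation n v)))"

definition Price :: "(real \<Rightarrow> real) \<Rightarrow> real set \<Rightarrow> nat \<Rightarrow> real" where
  "Price F D n = (SUP p\<in>D. p * (1 - F p ^ n))"

definition APX :: "(real \<Rightarrow> real) \<Rightarrow> (real \<Rightarrow> real) \<Rightarrow> real set \<Rightarrow> nat \<Rightarrow> real" where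
  "APX F f D n = Myerson F f n / Price F D n"

definition U_objective :: "nat \<Rightarrow> real \<Rightarrow> real" where
  "U_objective n q =
     min (1 / (1 - (1 - exp (- harm n + 1)) ^ n)
            + q * (1 - q) ^ (n - 1) / (1 - (1 - q) ^ n))
         (integral {0..q} (\<lambda>z. (1 - (1 - z) ^ n) / z) / (1 - (1 - q) ^ n))"

text \<open>\<open>GREATEST\<close> is an attained maximum, not merely a supremum.\<close>

definition U :: "nat \<Rightarrow> real" where
  "U n = (GREATEST u. u \<in> U_objective n ` {1 / exp 1..1})"

end

theory Submission
  imports Defs
begin

text \<open>Parametrise valuations by \<open>t = - ln (1 - F x)\<close>. The inverse \<open>w\<close> of this map is concave for an
  MHR distribution, its slope \<open>g\<close> is the inverse hazard rate, the virtual valuation becomes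
  \<open>w - g\<close>, and the highest of \<open>n\<close> bids becomes the maximum of \<open>n\<close> standard exponential variables.
  Let \<open>\<tau> \<le> 1\<close> be the point where \<open>w - g\<close> changes sign, \<open>r = w \<tau>\<close> and \<open>q = exp (- \<tau>)\<close>. Integration
  by parts turns the optimal revenue into the revenue of the second-price auction with reserve \<open>r\<close>:
  \<open>n r q (1 - q)^(n - 1)\<close> plus the integral of \<open>w\<close> over \<open>{\<tau>..}\<close> against the density of the second
  highest of \<open>n\<close> exponential variables. On \<open>{\<tau>..}\<close> one has \<open>w t \<le> r + r (t - \<tau>)\<close>, which gives the
  second term of the minimum. For the first term, extend the integral to \<open>{0..}\<close>; the added part is
  at least \<open>(n - 1) r q (1 - q)^(n - 1)\<close> by concavity, and by Jensen's inequality the extended integral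
  is at most \<open>w (H\<^sub>n - 1)\<close>. Posting the prices \<open>r\<close> and \<open>w (H\<^sub>n - 1)\<close> bounds the optimal pricing
  revenue from below. As for the size of \<open>U n\<close>, the first term alone is below \<open>U 3\<close> when \<open>n \<ge> 4\<close>; since
  \<open>n exp (1 - H\<^sub>n)\<close> increases with \<open>n\<close>, only finitely many \<open>n\<close> need a separate estimate.\<close>

section \<open>Calculus with countably many exceptional points\<close>

text \<open>If the right end value were smaller, uncountably many values would lie in between, so
  one of them, \<open>y\<close>, is not taken on \<open>S\<close>. At the last point where
  \<open>y\<close> is attained the derivative is positive, hence the function rises above
  \<open>y\<close> and has to cross it again later, a contradiction.\<close>

lemma pos_deriv_countable_exceptions:
  fixes \<Phi> d :: "real \<Rightarrow> real"
  assumes "a \<le> b" "continuous_on {a..b} \<Phi>" "countable S"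
    and deriv: "\<And>x. a < x \<Longrightarrow> x < b \<Longrightarrow> x \<notin> S \<Longrightarrow> (\<Phi> has_real_derivative d x) (at x)"
    and pos: "\<And>x. a < x \<Longrightarrow> x < b \<Longrightarrow> x \<notin> S \<Longrightarrow> 0 < d x"
  shows "\<Phi> a \<le> \<Phi> b"
proof (rule ccontr)
  assume "\<not> \<Phi> a \<le> \<Phi> b"
  then have lt: "\<Phi> b < \<Phi> a" by simp
  have "uncountable {\<Phi> b<..<\<Phi> a}" using lt by (simp add: uncountable_open_interval)
  moreover have "countable (\<Phi> ` S)" using assms by blast
  ultimately have "\<not> {\<Phi> b<..<\<Phi> a} \<subseteq> \<Phi> ` S" using countable_subset by blast
  then obtain y where y: "\<Phi> b < y" "y < \<Phi> a" "y \<notin> \<Phi> ` S"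
    by (metis greaterThanLessThan_iff subsetI)
  define A where "A = {x\<in>{a..b}. \<Phi> x = y}"
  have "A \<noteq> {}"
    using IVT2'[of \<Phi> b y a] y assms by (force simp: A_def)
  have "closed A"
    unfolding A_def by (intro continuous_closed_preimage_constant assms) auto
  have bdd: "bdd_above A" by (auto simp: A_def bdd_above_def)
  have "Sup A \<in> A" using \<open>A \<noteq> {}\<close> \<open>closed A\<close> bdd closed_contains_Sup by blast
  define x0 where "x0 = Sup A"
  have x0: "a \<le> x0" "x0 \<le> b" "\<Phi> x0 = y" using \<open>Sup A \<in> A\<close> by (auto simp: A_def x0_def)
  have "a < x0" "x0 < b" using x0 y by (metis less_irrefl order_le_less)+
  have "x0 \<notin> S" using x0 y by auto
  obtain e where e: "0 < e" "\<And>h. 0 < h \<Longrightarrow> h < e \<Longrightarrow> \<Phi> x0 < \<Phi> (x0 + h)"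
    using DERIV_pos_inc_right[OF deriv pos] \<open>a < x0\<close> \<open>x0 < b\<close> \<open>x0 \<notin> S\<close> by metis
  define h where "h = min (e/2) (b - x0)"
  have h: "0 < h" "h < e" "x0 + h \<le> b" using e \<open>x0 < b\<close> by (auto simp: h_def min_def)
  have "y < \<Phi> (x0 + h)" using e h x0 by auto
  then obtain x where "x0 + h \<le> x" "x \<le> b" "\<Phi> x = y"
    using IVT2'[of \<Phi> b y "x0+h"] y h x0 continuous_on_subset[OF assms(2), of "{x0+h..b}"] by force
  then have "x \<in> A" using h x0 by (auto simp: A_def)
  then have "x \<le> x0" using bdd cSup_upper x0_def by blast
  then show False using \<open>x0 + h \<le> x\<close> h by simp
qed

text \<open>Adding a small linear term makes the derivative strictly positive; the slope is then
  sent to zero.\<close>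

lemma nonneg_deriv_countable_exceptions:
  fixes \<Phi> d :: "real \<Rightarrow> real"
  assumes "a \<le> b" "continuous_on {a..b} \<Phi>" "countable S"
    and deriv: "\<And>x. a < x \<Longrightarrow> x < b \<Longrightarrow> x \<notin> S \<Longrightarrow> (\<Phi> has_real_derivative d x) (at x)"
    and nonneg: "\<And>x. a < x \<Longrightarrow> x < b \<Longrightarrow> x \<notin> S \<Longrightarrow> 0 \<le> d x"
  shows "\<Phi> a \<le> \<Phi> b"
proof (rule field_le_epsilon)
  fix e :: real assume "0 < e"
  define c where "c = e / (b - a + 1)"
  have "0 < c" using \<open>0 < e\<close> assms(1) by (simp add: c_def)
  have "\<Phi> a + c * a \<le> \<Phi> b + c * b"
  proof (rule pos_deriv_countable_exceptions[where \<Phi> = "\<lambda>x. \<Phi> x + c * x" and d = "\<lambda>x. d x + c" and S = S])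
    show "((\<lambda>x. \<Phi> x + c * x) has_real_derivative d x + c) (at x)" if "a < x" "x < b" "x \<notin> S" for x
      using deriv[OF that] by (auto intro!: derivative_eq_intros)
    show "0 < d x + c" if "a < x" "x < b" "x \<notin> S" for x
      using nonneg[OF that] \<open>0 < c\<close> by simp
  qed (use assms in \<open>auto intro!: continuous_intros\<close>)
  moreover have "c * (b - a) \<le> e"
    using \<open>0 < e\<close> assms(1) by (simp add: c_def field_simps)
  ultimately show "\<Phi> a \<le> \<Phi> b + e" by (simp add: algebra_simps)
qed

text \<open>Serves integrands containing the monotone slope \<open>g\<close>, which may jump at
  countably many points. Off \<open>S\<close> the indefinite integral and the given function have
  equal derivatives, so their difference is monotone in both directions.\<close>

lemma FTC_countable_exceptions:
  fixes \<Phi> p :: "real \<Rightarrow> real"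
  assumes "a \<le> b" "continuous_on {a..b} \<Phi>" "countable S" "p integrable_on {a..b}"
    and deriv: "\<And>x. a < x \<Longrightarrow> x < b \<Longrightarrow> x \<notin> S \<Longrightarrow> (\<Phi> has_real_derivative p x) (at x)"
    and cont: "\<And>x. a < x \<Longrightarrow> x < b \<Longrightarrow> x \<notin> S \<Longrightarrow> isCont p x"
  shows "(p has_integral \<Phi> b - \<Phi> a) {a..b}"
proof -
  define P where "P x = integral {a..x} p" for x
  have contP: "continuous_on {a..b} P"
    unfolding P_def using assms by (intro indefinite_integral_continuous_1)
  have dP: "(P has_real_derivative p x) (at x)" if "a < x" "x < b" "x \<notin> S" for x
  proof -
    have "((\<lambda>u. integral {a..u} p) has_vector_derivative p x) (at x within {a..b})"
      using that assms cont[OF that]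
      by (intro integral_has_vector_derivative_continuous_at[where S = "{}", simplified])
         (auto intro: continuous_at_imp_continuous_at_within)
    moreover have "at x within {a..b} = at x"
      using that by (intro at_within_interior) auto
    ultimately show ?thesis
      unfolding P_def[abs_def] has_real_derivative_iff_has_vector_derivative by simp
  qed
  have "\<Phi> a - P a \<le> \<Phi> b - P b"
    by (rule nonneg_deriv_countable_exceptions[where \<Phi> = "\<lambda>x. \<Phi> x - P x" and d = "\<lambda>x. p x - p x" and S = S])
       (use assms contP in \<open>auto intro!: continuous_intros DERIV_diff[THEN DERIV_cong] deriv dP\<close>)
  moreover have "P a - \<Phi> a \<le> P b - \<Phi> b"
    by (rule nonneg_deriv_countable_exceptions[where \<Phi> = "\<lambda>x. P x - \<Phi> x" and d = "\<lambda>x. p x - p x" and S = S])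
       (use assms contP in \<open>auto intro!: continuous_intros DERIV_diff[THEN DERIV_cong] deriv dP\<close>)
  moreover have "P a = 0" by (simp add: P_def)
  ultimately have "integral {a..b} p = \<Phi> b - \<Phi> a" by (simp add: P_def)
  then show ?thesis using assms(4) by (metis integrable_integral)
qed

section \<open>The function \<open>U\<close>\<close>

lemma one_minus_power: "1 - (1 - z) ^ n = z * (\<Sum>k<n. (1 - z) ^ k)" for z :: real
  using one_diff_power_eq[of "1 - z" n] by simp

text \<open>The integrand is a finite geometric sum in \<open>1 - z\<close>, integrated termwise. At
  \<open>z = 0\<close> division by zero gives \<open>0\<close> instead of \<open>n\<close>; that one
  point is spiked out.\<close>

lemma has_integral_one_minus_power_over:
  fixes q :: real
  assumes "0 \<le> q"
  shows "((\<lambda>z. (1 - (1 - z) ^ n) / z) has_integral (\<Sum>j<n. (1 - (1 - q) ^ Suc j) / real (Suc j))) {0..q}"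
proof -
  have "((\<lambda>z. \<Sum>k<n. (1 - z) ^ k) has_integral
      (\<Sum>j<n. (1 - (1 - q) ^ Suc j) / real (Suc j)) - (\<Sum>j<n. (1 - (1 - 0) ^ Suc j) / real (Suc j))) {0..q}"
  proof (rule fundamental_theorem_of_calculus[OF assms])
    fix x :: real
    have "((\<lambda>q. (1 - (1 - q) ^ Suc j) / real (Suc j)) has_real_derivative (1 - x) ^ j) (at x within {0..q})" for j
      by (rule derivative_eq_intros refl | simp)+
    then show "((\<lambda>q. \<Sum>j<n. (1 - (1 - q) ^ Suc j) / real (Suc j)) has_vector_derivative (\<Sum>k<n. (1 - x) ^ k))
        (at x within {0..q})"
      unfolding has_real_derivative_iff_has_vector_derivative[symmetric] by (intro DERIV_sum)
  qed
  then show ?thesis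
    by (rule has_integral_spike_finite[rotated 2, where S = "{0}", THEN has_integral_eq_rhs])
      (auto simp: one_minus_power)
qed

definition first_bound :: "nat \<Rightarrow> real \<Rightarrow> real" where
  "first_bound n q = 1 / (1 - (1 - exp (- harm n + 1)) ^ n) + q * (1 - q) ^ (n - 1) / (1 - (1 - q) ^ n)"

definition second_bound :: "nat \<Rightarrow> real \<Rightarrow> real" where
  "second_bound n q = (\<Sum>j<n. (1 - (1 - q) ^ Suc j) / real (Suc j)) / (1 - (1 - q) ^ n)"

lemma U_objective_eq: "0 \<le> q \<Longrightarrow> U_objective n q = min (first_bound n q) (second_bound n q)"
  unfolding U_objective_def first_bound_def second_bound_def
  by (simp only: integral_unique[OF has_integral_one_minus_power_over])

lemma inverse_e_pos: "0 < 1 / exp (1::real)" by simp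

lemma one_minus_power_pos:
  fixes q :: real assumes "0 < q" "q \<le> 1" "0 < n" shows "0 < 1 - (1 - q) ^ n"
proof -
  have "(1 - q) ^ n \<le> (1 - q) ^ 1" by (rule power_decreasing) (use assms in auto)
  then show ?thesis using assms by simp
qed

lemma continuous_on_U_objective:
  assumes "0 < n" shows "continuous_on {1 / exp 1..1} (U_objective n)"
proof -
  have pos: "0 < q" if "q \<in> {1 / exp 1..1}" for q :: real
    using that inverse_e_pos by (metis atLeastAtMost_iff order_less_le_trans)
  have "continuous_on {1 / exp 1..1} (\<lambda>q. min (first_bound n q) (second_bound n q))"
    unfolding first_bound_def second_bound_def
    using one_minus_power_pos[OF pos _ assms]
    by (intro continuous_intros ballI) fastforce+
  then show ?thesis
    by (rule continuous_on_eq) (use pos in \<open>auto simp: U_objective_eq less_imp_le\<close>)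
qed

text \<open>Continuity on a compact interval supplies the maximum without which
  \<open>GREATEST\<close> in \<open>U\<close> would be unspecified.\<close>

lemma U_attained:
  assumes "0 < n"
  obtains q where "1 / exp 1 \<le> q" "q \<le> 1" "U n = U_objective n q"
    "\<And>q'. 1 / exp 1 \<le> q' \<Longrightarrow> q' \<le> 1 \<Longrightarrow> U_objective n q' \<le> U n"
proof -
  have "{1 / exp 1..1::real} \<noteq> {}" by simp
  then obtain q where q: "q \<in> {1 / exp 1..1}" "\<And>q'. q' \<in> {1 / exp 1..1} \<Longrightarrow> U_objective n q' \<le> U_objective n q"
    using continuous_attains_sup[OF compact_Icc _ continuous_on_U_objective[OF assms]] by blast
  then have "U n = U_objective n q"
    unfolding U_def by (intro Greatest_equality) auto
  with q show ?thesis by (intro that) auto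
qed

lemma U_leI:
  assumes "0 < n"
    and "\<And>q. 1 / exp 1 \<le> q \<Longrightarrow> q \<le> 1 \<Longrightarrow> first_bound n q \<le> B \<or> second_bound n q \<le> B"
  shows "U n \<le> B"
proof -
  obtain q where q: "1 / exp 1 \<le> q" "q \<le> 1" "U n = U_objective n q"
    using U_attained[OF assms(1)] by metis
  then have "0 \<le> q" using inverse_e_pos by linarith
  then show ?thesis using q assms(2)[of q] by (auto simp: U_objective_eq min_le_iff_disj)
qed

lemma U_geI:
  assumes "0 < n" "1 / exp 1 \<le> q" "q \<le> 1" "B \<le> first_bound n q" "B \<le> second_bound n q"
  shows "B \<le> U n"
proof -
  have "U_objective n q \<le> U n" using U_attained[OF assms(1)] assms by metis
  moreover have "0 \<le> q" using inverse_e_pos assms by linarith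
  ultimately show ?thesis using assms by (auto simp: U_objective_eq)
qed

section \<open>Rational estimates for U\<close>

lemma e_bounds: "27182 / 10000 < exp (1::real)" "exp (1::real) < 27183 / 10000"
proof -
  have "5837465777 / 2147483648 - inverse (2 ^ 32) \<le> exp (1::real)" "exp (1::real) \<le> 5837465777 / 2147483648 + inverse (2 ^ 32)"
    using e_approx_32 by linarith+
  then show "27182 / 10000 < exp (1::real)" "exp (1::real) < 27183 / 10000"
    by (auto elim!: order_less_le_trans order_le_less_trans)
qed

text \<open>Raising both sides to the power \<open>Suc k\<close> turns the bound into one on an
  integer power of \<open>exp 1\<close>, which rational bounds for \<open>exp 1\<close>
  settle.\<close>

lemma exp_rational_ge:
  fixes c :: real
  assumes "0 \<le> c" "c ^ Suc k * (27183 / 10000) ^ m \<le> 1"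
  shows "c \<le> exp (- (real m / real (Suc k)))"
proof (rule power_le_imp_le_base[of _ k])
  have "exp 1 ^ m \<le> (27183 / 10000 :: real) ^ m" using e_bounds by (intro power_mono) auto
  then have "c ^ Suc k * exp 1 ^ m \<le> c ^ Suc k * (27183 / 10000) ^ m"
    using assms by (intro mult_left_mono zero_le_power)
  then have "c ^ Suc k * exp 1 ^ m \<le> 1" using assms by linarith
  moreover have "exp 1 ^ m = exp (real m)" using exp_of_nat_mult[of m "1::real"] by simp
  moreover have "exp (- (real m / real (Suc k))) ^ Suc k = 1 / exp (real m)"
    using exp_of_nat_mult[of "Suc k" "- (real m / real (Suc k))"]
    by (simp add: exp_minus inverse_eq_divide del: of_nat_Suc power_Suc)
  ultimately show "c ^ Suc k \<le> exp (- (real m / real (Suc k))) ^ Suc k"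
    by (simp add: pos_le_divide_eq del: power_Suc of_nat_Suc)
qed (use assms in auto)

lemma exp_rational_le:
  fixes c :: real
  assumes "0 \<le> c" "1 \<le> c ^ Suc k * (27182 / 10000) ^ m"
  shows "exp (- (real m / real (Suc k))) \<le> c"
proof (rule power_le_imp_le_base[of _ k])
  have "(27182 / 10000 :: real) ^ m \<le> exp 1 ^ m" using e_bounds by (intro power_mono) auto
  then have "c ^ Suc k * (27182 / 10000) ^ m \<le> c ^ Suc k * exp 1 ^ m"
    using assms by (intro mult_left_mono zero_le_power)
  then have "1 \<le> c ^ Suc k * exp 1 ^ m" using assms by linarith
  moreover have "exp 1 ^ m = exp (real m)" using exp_of_nat_mult[of m "1::real"] by simp
  moreover have "exp (- (real m / real (Suc k))) ^ Suc k = 1 / exp (real m)"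
    using exp_of_nat_mult[of "Suc k" "- (real m / real (Suc k))"]
    by (simp add: exp_minus inverse_eq_divide del: of_nat_Suc power_Suc)
  ultimately show "exp (- (real m / real (Suc k))) ^ Suc k \<le> c ^ Suc k"
    by (simp add: pos_divide_le_eq del: power_Suc of_nat_Suc)
qed (use assms in auto)

lemma leading_term_le:
  fixes c p :: real
  assumes "c \<le> exp (- harm n + 1)" "harm n \<ge> (1::real)" "(1 - c) ^ n \<le> p" "p < 1"
  shows "1 / (1 - (1 - exp (- harm n + 1)) ^ n) \<le> 1 / (1 - p)"
proof -
  have "(1 - exp (- harm n + 1)) ^ n \<le> (1 - c) ^ n"
    using assms by (intro power_mono) auto
  then show ?thesis using assms by (intro divide_left_mono) auto
qed

text \<open>With \<open>u = 1 - q\<close> a factor \<open>1 - u\<close> cancels and leaves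
  \<open>u ^ (n - 1)\<close> over the geometric sum. This ratio increases in \<open>u\<close>, as
  termwise cross-multiplication shows.\<close>

lemma trailing_term_le:
  fixes q c :: real
  assumes "0 < q" "q \<le> 1" "1 - q \<le> c" "0 < n"
  shows "q * (1 - q) ^ (n - 1) / (1 - (1 - q) ^ n) \<le> c ^ (n - 1) / (\<Sum>j<n. c ^ j)"
proof -
  define u where "u = 1 - q"
  have u: "0 \<le> u" "u \<le> c" using assms by (auto simp: u_def)
  have pos: "0 < (\<Sum>j<n. x ^ j)" if "0 \<le> x" for x :: real
  proof -
    have "x ^ 0 \<le> (\<Sum>j<n. x ^ j)" using assms(4) that by (intro member_le_sum) auto
    then show ?thesis by simp
  qed
  have "u ^ (n - 1) * c ^ j \<le> c ^ (n - 1) * u ^ j" if "j < n" for j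
  proof -
    have "u ^ (n - 1) = u ^ (n - 1 - j) * u ^ j" "c ^ (n - 1) = c ^ (n - 1 - j) * c ^ j"
      using that by (simp_all add: power_add[symmetric])
    moreover have "u ^ (n - 1 - j) \<le> c ^ (n - 1 - j)" using u by (intro power_mono)
    ultimately show ?thesis
      using u mult_right_mono[of "u ^ (n - 1 - j)" "c ^ (n - 1 - j)" "u ^ j * c ^ j"] by (simp add: mult_ac)
  qed
  then have "u ^ (n - 1) * (\<Sum>j<n. c ^ j) \<le> c ^ (n - 1) * (\<Sum>j<n. u ^ j)"
    unfolding sum_distrib_left by (intro sum_mono) auto
  then have "u ^ (n - 1) / (\<Sum>j<n. u ^ j) \<le> c ^ (n - 1) / (\<Sum>j<n. c ^ j)"
    using pos[of u] pos[of c] u by (simp add: frac_le_eq divide_nonpos_pos algebra_simps)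
  moreover have "q * (1 - q) ^ (n - 1) / (1 - (1 - q) ^ n) = u ^ (n - 1) / (\<Sum>j<n. u ^ j)"
    unfolding one_minus_power using assms(1) by (simp add: u_def)
  ultimately show ?thesis by simp
qed

lemma one_minus_inverse_e: "1 / exp 1 \<le> q \<Longrightarrow> 1 - q \<le> 6322 / 10000" for q :: real
proof -
  assume "1 / exp 1 \<le> q"
  moreover have "10000 / 27183 < 1 / exp (1::real)" using e_bounds by (simp add: field_simps)
  ultimately show ?thesis by simp
qed

lemma exp_harm_3: "exp (- harm 3 + 1) = exp (- (real 5 / real (Suc 5)))"
  by (simp add: harm_expand)

lemma U_3_le: "U 3 \<le> 1354 / 1000"
proof (rule U_leI)
  fix q :: real assume q: "1 / exp 1 \<le> q" "q \<le> 1"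
  have "0 < q" using q inverse_e_pos by linarith
  \<comment> \<open>The two terms cross near \<open>q = 0.5237\<close>; the second one is small
    enough up to \<open>0.5238\<close>, the first one beyond.\<close>
  show "first_bound 3 q \<le> 1354 / 1000 \<or> second_bound 3 q \<le> 1354 / 1000"
  proof (cases "q \<le> 5238 / 10000")
    case True
    have *: "(\<Sum>j<3. (1 - (1 - q) ^ Suc j) / real (Suc j)) = q * (3 - 3/2 * q + q * q / 3)"
      "1 - (1 - q) ^ 3 = q * (3 - 3 * q + q * q)"
      by (simp_all add: numeral_3_eq_3 algebra_simps add_divide_distrib diff_divide_distrib)
    have pos: "0 < 3 - 3 * q + q * q" using q True mult_pos_pos[OF \<open>0 < q\<close> \<open>0 < q\<close>] by linarith
    \<comment> \<open>The claim amounts to nonnegativity of a quadratic with roots near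
      \<open>0.52385\<close> and \<open>1.986\<close>. Rounding both roots down gives an explicit
      product from which it follows linearly.\<close>
    have "0 \<le> (5238 / 10000 - q) * (198 / 100 - q)" using True q by (intro mult_nonneg_nonneg) auto
    also have "\<dots> = 1037124 / 1000000 - 25038 / 10000 * q + q * q"
      by (simp add: algebra_simps add_divide_distrib diff_divide_distrib)
    finally have "3 - 3/2 * q + q * q / 3 \<le> 4062 / 1000 - 4062 / 1000 * q + 1354 / 1000 * (q * q)"
      using True by linarith
    also have "\<dots> = 1354 / 1000 * (3 - 3 * q + q * q)"
      by (simp add: algebra_simps)
    finally have "3 - 3/2 * q + q * q / 3 \<le> 1354 / 1000 * (3 - 3 * q + q * q)" .
    then have "q * (3 - 3/2 * q + q * q / 3) \<le> 1354 / 1000 * (q * (3 - 3 * q + q * q))"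
      using \<open>0 < q\<close> mult_left_mono[of _ _ q] by (metis less_imp_le mult.left_commute)
    then have "second_bound 3 q \<le> 1354 / 1000"
      unfolding second_bound_def * using mult_pos_pos[OF \<open>0 < q\<close> pos] by (simp only: pos_divide_le_eq)
    then show ?thesis ..
  next
    case False
    have "4345 / 10000 \<le> exp (- harm 3 + 1 :: real)"
      unfolding exp_harm_3 by (rule exp_rational_ge) (simp_all add: power_divide)
    then have "1 / (1 - (1 - exp (- harm 3 + 1 :: real)) ^ 3) \<le> 1 / (1 - 1808414 / 10000000)"
      by (rule leading_term_le) (simp_all add: harm_expand power_divide)
    moreover have "q * (1 - q) ^ (3 - 1) / (1 - (1 - q) ^ 3) \<le> (4762 / 10000) ^ (3 - 1) / (\<Sum>j<3. (4762 / 10000) ^ j)"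
      using q False \<open>0 < q\<close> by (intro trailing_term_le) auto
    moreover have "(4762 / 10000) ^ (3 - 1) / (\<Sum>j<3. (4762 / 10000 :: real) ^ j) \<le> 1332 / 10000"
      by (simp add: numeral_3_eq_3)
    ultimately have "first_bound 3 q \<le> 1 / (1 - 1808414 / 10000000) + 1332 / 10000"
      unfolding first_bound_def by (meson add_mono order_trans)
    then have "first_bound 3 q \<le> 1354 / 1000" by simp
    then show ?thesis ..
  qed
qed simp

text \<open>Evaluation close to the crossing point of the two terms. The value \<open>1.353\<close>
  is the threshold that every other \<open>U n\<close> is compared with.\<close>

lemma U_3_ge: "1353 / 1000 \<le> U 3"
proof (rule U_geI)
  have "exp (- harm 3 + 1 :: real) \<le> 4347 / 10000"
    unfolding exp_harm_3 by (rule exp_rational_le) (simp_all add: power_divide)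
  then have "(5653 / 10000) ^ 3 \<le> (1 - exp (- harm 3 + 1 :: real)) ^ 3"
    by (intro power_mono) auto
  moreover have "(1 - exp (- harm 3 + 1 :: real)) ^ 3 < 1"
    by (simp add: power_less_one_iff harm_expand)
  ultimately have "1 / (1 - (5653 / 10000) ^ 3) \<le> 1 / (1 - (1 - exp (- harm 3 + 1 :: real)) ^ 3)"
    by (intro divide_left_mono) (auto simp: power_divide)
  then show "1353 / 1000 \<le> first_bound 3 (5235 / 10000)"
    unfolding first_bound_def by (simp add: power_divide)
  show "1353 / 1000 \<le> second_bound 3 (5235 / 10000)"
    unfolding second_bound_def by (simp add: eval_nat_numeral)
  show "1 / exp 1 \<le> (5235 / 10000 :: real)"
    using e_bounds by (simp add: field_simps)
qed simp_all

lemma U_2_le: "U 2 \<le> 1353 / 1000"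
proof (rule U_leI)
  fix q :: real assume q: "1 / exp 1 \<le> q" "q \<le> 1"
  have "0 < q" using q inverse_e_pos by linarith
  show "first_bound 2 q \<le> 1353 / 1000 \<or> second_bound 2 q \<le> 1353 / 1000"
  \<comment> \<open>For \<open>n = 2\<close> the second term reaches \<open>1.353\<close> only near
    \<open>q = 0.828\<close>, so the split at \<open>0.81\<close> leaves slack on both
    sides.\<close>
  proof (cases "q \<le> 81 / 100")
    case True
    have *: "(\<Sum>j<2. (1 - (1 - q) ^ Suc j) / real (Suc j)) = q * (2 - q / 2)"
      "1 - (1 - q) ^ 2 = q * (2 - q)"
      by (simp_all add: numeral_2_eq_2 algebra_simps add_divide_distrib diff_divide_distrib)
    have "second_bound 2 q \<le> 1353 / 1000"
      unfolding second_bound_def * using \<open>0 < q\<close> True by (simp add: pos_divide_le_eq)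
    then show ?thesis ..
  next
    case False
    have "exp (- harm 2 + 1) = exp (- (real 1 / real (Suc 1)))"
      by (simp add: harm_expand)
    moreover have "606 / 1000 \<le> exp (- (real 1 / real (Suc 1)))"
      by (rule exp_rational_ge) (simp_all add: power_divide)
    ultimately have "606 / 1000 \<le> exp (- harm 2 + 1 :: real)" by simp
    then have "1 / (1 - (1 - exp (- harm 2 + 1 :: real)) ^ 2) \<le> 1 / (1 - 156 / 1000)"
      by (rule leading_term_le) (simp_all add: harm_expand power_divide)
    moreover have "q * (1 - q) ^ (2 - 1) / (1 - (1 - q) ^ 2) \<le> (19 / 100) ^ (2 - 1) / (\<Sum>j<2. (19 / 100) ^ j)"
      using q False \<open>0 < q\<close> by (intro trailing_term_le) auto
    moreover have "(19 / 100) ^ (2 - 1) / (\<Sum>j<2. (19 / 100 :: real) ^ j) \<le> 16 / 100"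
      by (simp add: numeral_2_eq_2)
    ultimately have "first_bound 2 q \<le> 1 / (1 - 156 / 1000) + 16 / 100"
      unfolding first_bound_def by (meson add_mono order_trans)
    then have "first_bound 2 q \<le> 1353 / 1000" by simp
    then show ?thesis ..
  qed
qed simp

text \<open>Uses the first term only. Its part depending on \<open>q\<close> is largest at the left
  end, where \<open>1 - q\<close> is below \<open>0.6322\<close>, and the resulting bound decreases
  in \<open>n\<close>, so its value at \<open>m\<close> covers all \<open>n \<ge> m\<close>.\<close>

lemma U_le_leading_trailing:
  assumes "0 < m" "m \<le> n" "1 / (1 - (1 - exp (- harm n + 1 :: real)) ^ n) \<le> A"
    and "A + (6322 / 10000) ^ (m - 1) / (\<Sum>j<m. (6322 / 10000) ^ j) \<le> 1353 / 1000"
  shows "U n \<le> 1353 / 1000"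
proof (rule U_leI)
  fix q :: real assume q: "1 / exp 1 \<le> q" "q \<le> 1"
  have "0 < q" using q inverse_e_pos by linarith
  have "q * (1 - q) ^ (n - 1) / (1 - (1 - q) ^ n) \<le> (6322 / 10000) ^ (n - 1) / (\<Sum>j<n. (6322 / 10000) ^ j)"
    using q \<open>0 < q\<close> one_minus_inverse_e[OF q(1)] assms by (intro trailing_term_le) auto
  also have "\<dots> \<le> (6322 / 10000) ^ (m - 1) / (\<Sum>j<m. (6322 / 10000) ^ j)"
  proof (intro frac_le power_decreasing)
    show "0 < (\<Sum>j<m. (6322 / 10000 :: real) ^ j)" using assms by (intro sum_pos) auto
    show "(\<Sum>j<m. (6322 / 10000 :: real) ^ j) \<le> (\<Sum>j<n. (6322 / 10000) ^ j)"
      using assms by (intro sum_mono2) auto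
  qed (use assms in auto)
  finally show "first_bound n q \<le> 1353 / 1000 \<or> second_bound n q \<le> 1353 / 1000"
    using assms unfolding first_bound_def by linarith
qed (use assms in simp)

lemma U_4_le: "U 4 \<le> 1353 / 1000"
proof (rule U_le_leading_trailing[where m = 4])
  have "exp (- harm 4 + 1) = exp (- (real 13 / real (Suc 11)))"
    by (simp add: harm_expand)
  moreover have "338 / 1000 \<le> exp (- (real 13 / real (Suc 11)))"
    by (rule exp_rational_ge) (simp_all add: power_divide)
  ultimately have "338 / 1000 \<le> exp (- harm 4 + 1 :: real)" by simp
  then show "1 / (1 - (1 - exp (- harm 4 + 1 :: real)) ^ 4) \<le> 1 / (1 - 193 / 1000)"
    by (rule leading_term_le) (simp_all add: harm_expand power_divide)
qed (simp_all add: eval_nat_numeral)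

lemma U_5_le: "U 5 \<le> 1353 / 1000"
proof (rule U_le_leading_trailing[where m = 5])
  \<comment> \<open>The exact exponent \<open>77/60\<close> is rounded up to \<open>13/10\<close>,
    which keeps the powers in the rational check small. For \<open>n = 6\<close> and
    \<open>n = 7\<close> the exponent is rounded up in the same way.\<close>
  have "exp (- (real 13 / real (Suc 9))) \<le> exp (- harm 5 + 1 :: real)"
    by (simp add: harm_expand)
  moreover have "272 / 1000 \<le> exp (- (real 13 / real (Suc 9)))"
    by (rule exp_rational_ge) (simp_all add: power_divide)
  ultimately have "272 / 1000 \<le> exp (- harm 5 + 1 :: real)" by linarith
  then show "1 / (1 - (1 - exp (- harm 5 + 1 :: real)) ^ 5) \<le> 1 / (1 - 205 / 1000)"
    by (rule leading_term_le) (simp_all add: harm_expand power_divide)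
qed (simp_all add: eval_nat_numeral)

lemma U_6_le: "U 6 \<le> 1353 / 1000"
proof (rule U_le_leading_trailing[where m = 6])
  have "exp (- (real 3 / real (Suc 1))) \<le> exp (- harm 6 + 1 :: real)"
    by (simp add: harm_expand)
  moreover have "223 / 1000 \<le> exp (- (real 3 / real (Suc 1)))"
    by (rule exp_rational_ge) (simp_all add: power_divide)
  ultimately have "223 / 1000 \<le> exp (- harm 6 + 1 :: real)" by linarith
  then show "1 / (1 - (1 - exp (- harm 6 + 1 :: real)) ^ 6) \<le> 1 / (1 - 221 / 1000)"
    by (rule leading_term_le) (simp_all add: harm_expand power_divide)
qed (simp_all add: eval_nat_numeral)

text \<open>One step multiplies the value by \<open>(n + 1) / n * exp (- 1 / (n + 1))\<close>, which
  is at least \<open>1\<close> because \<open>exp (- x) \<ge> 1 - x\<close>.\<close>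

lemma mult_exp_harm_mono:
  assumes "0 < k" "k \<le> n"
  shows "real k * exp (- harm k + 1) \<le> real n * exp (- harm n + 1 :: real)"
  using assms(2)
proof (induction n rule: dec_induct)
  case (step n)
  have "1 - 1 / real (Suc n) \<le> exp (- (1 / real (Suc n)))"
    using exp_ge_add_one_self[of "- (1 / real (Suc n))"] by simp
  then have "real n \<le> real (Suc n) * exp (- (1 / real (Suc n)))"
    by (simp add: field_simps)
  then have "real n * exp (- harm n + 1) \<le> real (Suc n) * exp (- (1 / real (Suc n))) * exp (- harm n + 1 :: real)"
    by (intro mult_right_mono) auto
  also have "\<dots> = real (Suc n) * exp (- harm (Suc n) + 1)"
    by (simp add: harm_Suc exp_add[symmetric] inverse_eq_divide mult.assoc del: of_nat_Suc)
  finally show ?case using step by simp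
qed simp

text \<open>A bound uniform in \<open>n\<close>: with \<open>x = exp (1 - harm n)\<close> one has
  \<open>(1 - x) ^ n \<le> exp (- n x)\<close>, and \<open>n x\<close> is at least its value at
  \<open>7\<close>, which exceeds \<open>7/5\<close>.\<close>

lemma U_ge_7_le:
  assumes "7 \<le> n" shows "U n \<le> 1353 / 1000"
proof (rule U_le_leading_trailing[where m = 7])
  define x :: real where "x = exp (- harm n + 1)"
  have "exp (- (real 8 / real (Suc 4))) \<le> exp (- harm 7 + 1 :: real)"
    by (simp add: harm_expand)
  moreover have "2015 / 10000 \<le> exp (- (real 8 / real (Suc 4)))"
    by (rule exp_rational_ge) (simp_all add: power_divide)
  ultimately have "2015 / 10000 \<le> exp (- harm 7 + 1 :: real)" by linarith
  then have nx: "7 / 5 \<le> real n * x"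
    using mult_exp_harm_mono[of 7 n] assms by (simp add: x_def)
  have "(1::real) = harm 1" by (simp add: harm_def)
  also have "\<dots> \<le> harm n" using assms by (intro harm_mono) auto
  finally have "x \<le> 1" by (simp add: x_def)
  then have "(1 - x) ^ n \<le> exp (- x) ^ n"
    using exp_ge_add_one_self[of "- x"] by (intro power_mono) auto
  also have "\<dots> = exp (- (real n * x))" by (simp add: exp_of_nat_mult[symmetric])
  also have "\<dots> \<le> exp (- (real 7 / real (Suc 4)))" using nx by simp
  also have "\<dots> \<le> 2467 / 10000"
    by (rule exp_rational_le) (simp_all add: power_divide)
  finally show "1 / (1 - (1 - exp (- harm n + 1 :: real)) ^ n) \<le> 1 / (1 - 2467 / 10000)"
    unfolding x_def by (intro divide_left_mono) auto
qed (use assms in \<open>simp_all add: eval_nat_numeral\<close>)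

lemma U_le_U_3:
  assumes "2 \<le> n" shows "U n \<le> U 3"
proof -
  consider "n = 2" | "n = 3" | "n = 4" | "n = 5" | "n = 6" | "7 \<le> n" using assms by linarith
  then show ?thesis
  proof cases
    case 2 then show ?thesis by simp
  next
    case 6 then show ?thesis using U_ge_7_le[of n] U_3_ge by linarith
  qed (use U_2_le U_4_le U_5_le U_6_le U_3_ge in \<open>auto intro: order_trans\<close>)
qed

section \<open>Order statistics of exponential variables\<close>

definition level :: "real \<Rightarrow> real" where
  "level t = 1 - exp (- t)"

definition max_density :: "nat \<Rightarrow> real \<Rightarrow> real" where
  "max_density n t = real n * exp (- t) * level t ^ (n - 1)"

definition second_density :: "nat \<Rightarrow> real \<Rightarrow> real" where
  "second_density n t = real n * real (n - 1) * exp (- t) ^ 2 * level t ^ (n - 2)"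

text \<open>The argument is the quantile \<open>u = level t\<close>: this is the cdf of the second
  highest of \<open>n\<close> uniform variables, where all of them, or all but one, lie below
  \<open>u\<close>.\<close>

definition second_cdf :: "nat \<Rightarrow> real \<Rightarrow> real" where
  "second_cdf n u = real n * u ^ (n - 1) - real (n - 1) * u ^ n"

text \<open>\<open>second_mean n (level t)\<close> is the integral of the tail \<open>1 - second_cdf n (level s)\<close> over \<open>{0..t}\<close>.\<close>

definition second_mean :: "nat \<Rightarrow> real \<Rightarrow> real" where
  "second_mean n u = (\<Sum>j<n - 1. u ^ Suc j / real (Suc j)) - real (n - 1) * u ^ n / real n"

lemma level_bounds: "0 \<le> t \<Longrightarrow> 0 \<le> level t" "level t < 1" "0 < t \<Longrightarrow> 0 < level t"
  by (auto simp: level_def)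

lemma exp_level: "exp (- t) = 1 - level t"
  by (simp add: level_def)

lemma has_derivative_level: "(level has_real_derivative exp (- t)) (at t within A)"
  unfolding level_def[abs_def] by (rule derivative_eq_intros refl | simp)+

lemma continuous_on_level [continuous_intros]: "continuous_on A level"
  unfolding level_def[abs_def] by (intro continuous_intros)

lemma continuous_on_densities [continuous_intros]:
  "continuous_on A (max_density n)" "continuous_on A (second_density n)"
  unfolding max_density_def[abs_def] second_density_def[abs_def] by (intro continuous_intros)+

lemma borel_max_density [measurable]: "max_density n \<in> borel_measurable borel"
  by (intro borel_measurable_continuous_onI continuous_intros)

lemma densities_nonneg: "0 \<le> t \<Longrightarrow> 0 \<le> max_density n t" "0 \<le> t \<Longrightarrow> 0 \<le> second_density n t"
  unfolding max_density_def second_density_def using level_bounds by auto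

lemma DERIV_second_cdf:
  assumes "2 \<le> n"
  shows "(second_cdf n has_real_derivative real n * real (n - 1) * u ^ (n - 2) * (1 - u)) (at u within A)"
proof -
  obtain m where n: "n = Suc (Suc m)" using assms by (metis add_2_eq_Suc le_Suc_ex)
  show ?thesis unfolding second_cdf_def[abs_def] n
    by (rule derivative_eq_intros refl)+ (simp add: algebra_simps)
qed

lemma DERIV_second_mean:
  assumes "2 \<le> n"
  shows "(second_mean n has_real_derivative (\<Sum>j<n - 1. u ^ j) - real (n - 1) * u ^ (n - 1)) (at u within A)"
proof -
  have 1: "((\<lambda>u. u ^ Suc j / real (Suc j)) has_real_derivative u ^ j) (at u within A)" for j
    by (rule derivative_eq_intros refl | simp)+
  have "((\<lambda>u. real (n - 1) * u ^ n / real n) has_real_derivative real (n - 1) * u ^ (n - 1)) (at u within A)"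
    using assms by (auto intro!: derivative_eq_intros)
  then show ?thesis
    unfolding second_mean_def[abs_def] by (intro DERIV_diff DERIV_sum 1)
qed

text \<open>The factor \<open>1 - u\<close> is the derivative of \<open>level\<close> at
  \<open>u = level t\<close>, and the other factor is the derivative of \<open>second_mean\<close>.
  Hence \<open>second_mean n (level t)\<close> has the tail as its derivative in
  \<open>t\<close>.\<close>

lemma one_minus_second_cdf:
  assumes "2 \<le> n"
  shows "1 - second_cdf n u = ((\<Sum>j<n - 1. u ^ j) - real (n - 1) * u ^ (n - 1)) * (1 - u)"
proof -
  obtain m where n: "n = Suc (Suc m)" using assms by (metis add_2_eq_Suc le_Suc_ex)
  have S: "(\<Sum>j<n - 1. u ^ j) * (1 - u) = 1 - u ^ (n - 1)"
    by (simp only: one_diff_power_eq mult.commute)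
  show ?thesis
    unfolding second_cdf_def left_diff_distrib[of "sum _ _"] S by (simp add: n algebra_simps)
qed

lemma second_mean_deriv_nonneg:
  fixes u :: real
  assumes "0 \<le> u" "u \<le> 1"
  shows "0 \<le> (\<Sum>j<n - 1. u ^ j) - real (n - 1) * u ^ (n - 1)"
proof -
  have "(\<Sum>j<n - 1. u ^ (n - 1)) \<le> (\<Sum>j<n - 1. u ^ j)"
    by (intro sum_mono power_decreasing) (use assms in auto)
  then show ?thesis by simp
qed

lemma second_cdf_le_1:
  assumes "2 \<le> n" "0 \<le> u" "u \<le> 1" shows "second_cdf n u \<le> 1"
proof -
  have "0 \<le> 1 - second_cdf n u"
    unfolding one_minus_second_cdf[OF assms(1)] using second_mean_deriv_nonneg[of u n] assms
    by (intro mult_nonneg_nonneg) auto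
  then show ?thesis by simp
qed

text \<open>The mean of the second highest of \<open>n\<close> exponential variables: the highest
  has mean \<open>harm n\<close> and the gap between the two has mean \<open>1\<close>.\<close>

lemma second_mean_1: "2 \<le> n \<Longrightarrow> second_mean n 1 = harm n - 1"
proof -
  assume "2 \<le> n"
  then obtain m where n: "n = Suc (Suc m)" by (metis add_2_eq_Suc le_Suc_ex)
  have "harm (Suc m) = (\<Sum>j<n - 1. 1 / real (Suc j))"
    by (simp add: harm_altdef n inverse_eq_divide)
  moreover have "real (Suc m) / real (Suc (Suc m)) = 1 - inverse (real (Suc (Suc m)))"
    by (simp add: field_simps)
  ultimately show ?thesis unfolding second_mean_def n harm_Suc[of "Suc m"] by simp
qed

lemma second_mean_le:
  assumes "2 \<le> n" "0 \<le> u" "u \<le> 1" shows "second_mean n u \<le> harm n - 1"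
proof -
  have "second_mean n u \<le> second_mean n 1"
    by (rule DERIV_nonneg_imp_nondecreasing[OF assms(3)])
      (metis DERIV_second_mean[OF assms(1)] second_mean_deriv_nonneg assms(2) order_trans)
  then show ?thesis using second_mean_1 assms by simp
qed

lemma at_level_0: "2 \<le> n \<Longrightarrow> second_cdf n 0 = 0" "second_mean n 0 = 0"
  by (auto simp: second_cdf_def second_mean_def zero_power)

text \<open>Integration by parts: \<open>t - second_mean n (level t)\<close> is an antiderivative of
  the cdf \<open>second_cdf n (level t)\<close>.\<close>

lemma has_integral_affine_second_density:
  fixes \<alpha> \<beta> :: real
  assumes "2 \<le> n" "a \<le> b"
  defines "\<Psi> \<equiv> \<lambda>t. (\<alpha> + \<beta> * t) * second_cdf n (level t) - \<beta> * (t - second_mean n (level t))"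
  shows "((\<lambda>t. (\<alpha> + \<beta> * t) * second_density n t) has_integral \<Psi> b - \<Psi> a) {a..b}"
proof (rule fundamental_theorem_of_calculus[OF assms(2)])
  fix t
  let ?d = "(\<Sum>j<n - 1. level t ^ j) - real (n - 1) * level t ^ (n - 1)"
  have 1: "((\<lambda>t. second_cdf n (level t)) has_real_derivative second_density n t) (at t within {a..b})"
    by (rule DERIV_chain2[OF DERIV_second_cdf has_derivative_level, THEN DERIV_cong])
      (use assms in \<open>auto simp: second_density_def power2_eq_square level_def\<close>)
  have 2: "((\<lambda>t. second_mean n (level t)) has_real_derivative ?d * exp (- t)) (at t within {a..b})"
    by (rule DERIV_chain2[OF DERIV_second_mean has_derivative_level]) (use assms in auto)
  have "(\<Psi> has_real_derivative (\<alpha> + \<beta> * t) * second_density n t + \<beta> * second_cdf n (level t)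
      - \<beta> * (1 - ?d * exp (- t))) (at t within {a..b})"
    unfolding \<Psi>_def by (rule derivative_eq_intros 1 2 refl | simp)+
  moreover have "?d * exp (- t) = 1 - second_cdf n (level t)"
    unfolding one_minus_second_cdf[OF assms(1)] exp_level ..
  ultimately have "(\<Psi> has_real_derivative (\<alpha> + \<beta> * t) * second_density n t) (at t within {a..b})"
    by simp
  then show "(\<Psi> has_vector_derivative (\<alpha> + \<beta> * t) * second_density n t) (at t within {a..b})"
    by (simp add: has_real_derivative_iff_has_vector_derivative)
qed

text \<open>The left side is the factor multiplying the reserve price once valuations above the
  reserve are replaced by a line: the boundary term plus the integral of
  \<open>1 + (t - \<tau>)\<close> against the second-highest density. The right side is the
  numerator of \<open>second_bound\<close>.\<close>

lemma tail_kernel_identity: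
  assumes "2 \<le> n" and q: "q = 1 - u"
  shows "real n * q * u ^ (n - 1) + 1 - second_cdf n u + (harm n - 1) - second_mean n u
    = (\<Sum>j<n. (1 - (1 - q) ^ Suc j) / real (Suc j))"
proof -
  obtain m where n: "n = Suc (Suc m)" using assms by (metis add_2_eq_Suc le_Suc_ex)
  have "(\<Sum>j<n. (1 - (1 - q) ^ Suc j) / real (Suc j)) = (\<Sum>j<n. inverse (real (Suc j))) - (\<Sum>j<n. u ^ Suc j / real (Suc j))"
    unfolding sum_subtractf[symmetric] q by (intro sum.cong) (auto simp: divide_inverse left_diff_distrib)
  also have "\<dots> = harm n - (\<Sum>j<n - 1. u ^ Suc j / real (Suc j)) - u ^ n / real n"
    by (simp add: harm_altdef n)
  also have "u ^ n / real n = u ^ n - real (n - 1) * u ^ n / real n"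
    using assms by (simp add: field_simps n)
  finally show ?thesis
    unfolding second_mean_def second_cdf_def q by (simp add: n algebra_simps)
qed

lemma DERIV_level_power:
  "0 < n \<Longrightarrow> ((\<lambda>t. level t ^ n) has_real_derivative max_density n t) (at t within A)"
  unfolding max_density_def by (auto intro!: derivative_eq_intros has_derivative_level simp: mult_ac)

lemma has_integral_max_density:
  assumes "0 < n" "a \<le> b"
  shows "(max_density n has_integral level b ^ n - level a ^ n) {a..b}"
  using DERIV_level_power[OF assms(1)]
  by (intro fundamental_theorem_of_calculus[OF assms(2)]) (simp add: has_real_derivative_iff_has_vector_derivative)

section \<open>Concave valuation profiles\<close>

lemma exp_minus_1_div: "((\<lambda>h. (exp h - 1) / h) \<longlongrightarrow> (1::real)) (at 0)"
  using DERIV_exp[of "0::real"] by (simp add: DERIV_def)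

lemma one_minus_exp_div: "((\<lambda>h. (1 - exp (- h)) / h) \<longlongrightarrow> (1::real)) (at 0)"
proof -
  have "((\<lambda>x::real. - exp (- x)) has_real_derivative 1) (at 0)"
    by (auto intro!: derivative_eq_intros)
  then show ?thesis by (simp add: DERIV_def)
qed

text \<open>A squeeze in which the lower and the upper bound may change roles from point to point,
  as happens when a difference quotient changes the sign of its step.\<close>

lemma between_tendsto:
  fixes A B f :: "'a \<Rightarrow> real"
  assumes "(A \<longlongrightarrow> l) F" "(B \<longlongrightarrow> l) F"
    and "eventually (\<lambda>x. min (A x) (B x) \<le> f x \<and> f x \<le> max (A x) (B x)) F"
  shows "(f \<longlongrightarrow> l) F"
proof (rule tendsto_sandwich)
  show "eventually (\<lambda>x. min (A x) (B x) \<le> f x) F" "eventually (\<lambda>x. f x \<le> max (A x) (B x)) F"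
    using assms(3) by (simp_all add: eventually_conj_iff)
  show "((\<lambda>x. min (A x) (B x)) \<longlongrightarrow> l) F" "((\<lambda>x. max (A x) (B x)) \<longlongrightarrow> l) F"
    using tendsto_min[OF assms(1,2)] tendsto_max[OF assms(1,2)] by simp_all
qed

text \<open>\<open>w t\<close> is the valuation whose survival probability is \<open>exp (- t)\<close> and \<open>g t\<close> the inverse hazard
  rate there, so that \<open>w t - g t\<close> is the virtual valuation and \<open>w\<close> is concave with slope \<open>g\<close>.\<close>

locale valuation_profile =
  fixes w g :: "real \<Rightarrow> real"
  assumes g_pos: "0 < t \<Longrightarrow> 0 < g t"
    and g_antimono: "0 < s \<Longrightarrow> s \<le> t \<Longrightarrow> g t \<le> g s"
    and w_0_nonneg: "0 \<le> w 0"
    and w_right_continuous_0: "(w \<longlongrightarrow> w 0) (at_right 0)"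
    and increment_le: "0 < s \<Longrightarrow> s \<le> t \<Longrightarrow> w t - w s \<le> g s * (exp (t - s) - 1)"
    and increment_ge: "0 < s \<Longrightarrow> s \<le> t \<Longrightarrow> g t * (1 - exp (- (t - s))) \<le> w t - w s"
begin

definition exceptions :: "real set" where
  "exceptions = {t\<in>{0<..}. \<not> isCont g t}"

lemma countable_exceptions: "countable exceptions"
proof -
  have "mono_on {0<..} (\<lambda>t. - g t)" by (auto intro!: mono_onI g_antimono)
  then have "countable {t\<in>{0<..}. \<not> isCont (\<lambda>t. - g t) t}"
    by (intro mono_on_ctble_discont_open) auto
  moreover have "isCont g t" if "isCont (\<lambda>t. - g t) t" for t
    using isCont_minus[OF that] by simp
  ultimately show ?thesis
    unfolding exceptions_def by (elim countable_subset[rotated]) auto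
qed

lemma w_mono_pos: "0 < s \<Longrightarrow> s \<le> t \<Longrightarrow> w s \<le> w t"
  using increment_ge[of s t] g_pos[of t] by (smt (verit) exp_le_one_iff mult_nonneg_nonneg)

text \<open>The two increment axioms, applied forwards for positive \<open>h\<close> and backwards
  for negative \<open>h\<close>. Both bounds tend to \<open>g t\<close> wherever \<open>g\<close> is
  continuous, which yields the derivative of \<open>w\<close> there.\<close>

lemma quotient_between:
  assumes "0 < t" "h \<noteq> 0" "- t < h"
  shows "min (g t * ((exp h - 1) / h)) (g (t + h) * ((1 - exp (- h)) / h)) \<le> (w (t + h) - w t) / h"
    "(w (t + h) - w t) / h \<le> max (g t * ((exp h - 1) / h)) (g (t + h) * ((1 - exp (- h)) / h))"
proof -
  show "min (g t * ((exp h - 1) / h)) (g (t + h) * ((1 - exp (- h)) / h)) \<le> (w (t + h) - w t) / h"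
  proof (cases "0 < h")
    case True
    have "g (t + h) * (1 - exp (- h)) \<le> w (t + h) - w t"
      using increment_ge[of t "t + h"] assms True by simp
    then have "g (t + h) * (1 - exp (- h)) / h \<le> (w (t + h) - w t) / h"
      using True by (intro divide_right_mono) auto
    then show ?thesis by (simp add: min_le_iff_disj)
  next
    case False
    have "g t * (1 - exp h) \<le> w t - w (t + h)"
      using increment_ge[of "t + h" t] assms False by simp
    then have "g t * (exp h - 1) / h \<le> (w (t + h) - w t) / h"
      using False assms by (intro divide_right_mono_neg) (auto simp: algebra_simps)
    then show ?thesis by (simp add: min_le_iff_disj)
  qed
  show "(w (t + h) - w t) / h \<le> max (g t * ((exp h - 1) / h)) (g (t + h) * ((1 - exp (- h)) / h))"
  proof (cases "0 < h")
    case True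
    have "w (t + h) - w t \<le> g t * (exp h - 1)"
      using increment_le[of t "t + h"] assms True by simp
    then have "(w (t + h) - w t) / h \<le> g t * (exp h - 1) / h"
      using True by (intro divide_right_mono) auto
    then show ?thesis by (simp add: le_max_iff_disj)
  next
    case False
    have "w t - w (t + h) \<le> g (t + h) * (exp (- h) - 1)"
      using increment_le[of "t + h" t] assms False by simp
    then have "(w (t + h) - w t) / h \<le> g (t + h) * (1 - exp (- h)) / h"
      using False assms by (intro divide_right_mono_neg) (auto simp: algebra_simps)
    then show ?thesis by (simp add: le_max_iff_disj)
  qed
qed

lemma eventually_near_0: "0 < t \<Longrightarrow> eventually (\<lambda>h::real. h \<noteq> 0 \<and> - t < h) (at 0)"
proof -
  assume "0 < t"
  then have "eventually (\<lambda>h. h \<in> {- t<..}) (at 0)"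
    by (intro eventually_at_in_open') auto
  then show ?thesis
    using eventually_neq_at_within[of 0 0 UNIV] by eventually_elim auto
qed

lemma DERIV_w:
  assumes "0 < t" "t \<notin> exceptions"
  shows "(w has_real_derivative g t) (at t)"
proof -
  have cont: "isCont g t" using assms by (auto simp: exceptions_def)
  have "((\<lambda>h. (w (t + h) - w t) / h) \<longlongrightarrow> g t) (at 0)"
  proof (rule between_tendsto)
    show "((\<lambda>h. g t * ((exp h - 1) / h)) \<longlongrightarrow> g t) (at 0)"
      using tendsto_mult[OF tendsto_const exp_minus_1_div] by simp
    have "((\<lambda>h. g (t + h)) \<longlongrightarrow> g t) (at 0)"
      using cont by (simp add: isCont_iff)
    then show "((\<lambda>h. g (t + h) * ((1 - exp (- h)) / h)) \<longlongrightarrow> g t) (at 0)"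
      using tendsto_mult[OF _ one_minus_exp_div] by fastforce
    show "eventually (\<lambda>h. min (g t * ((exp h - 1) / h)) (g (t + h) * ((1 - exp (- h)) / h)) \<le> (w (t + h) - w t) / h
      \<and> (w (t + h) - w t) / h \<le> max (g t * ((exp h - 1) / h)) (g (t + h) * ((1 - exp (- h)) / h))) (at 0)"
      using eventually_near_0[OF assms(1)] by eventually_elim (use quotient_between assms in auto)
  qed
  then show ?thesis by (simp add: DERIV_def)
qed

text \<open>Holds also where \<open>g\<close> jumps: near \<open>t\<close> the slope is bounded by
  \<open>g (t / 2)\<close>, so increments vanish with \<open>h\<close>.\<close>

lemma isCont_w:
  assumes "0 < t" shows "isCont w t"
proof -
  have "((\<lambda>h. w (t + h) - w t) \<longlongrightarrow> 0) (at 0)"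
  proof (rule Lim_null_comparison)
    let ?G = "g (t / 2)"
    have "eventually (\<lambda>h. h \<in> {- (t/2)<..<1}) (at 0)"
      using assms by (intro eventually_at_in_open') auto
    then show "eventually (\<lambda>h. norm (w (t + h) - w t) \<le> ?G * \<bar>exp \<bar>h\<bar> - 1\<bar>) (at 0)"
    proof eventually_elim
      case (elim h)
      show ?case
      proof (cases "0 \<le> h")
        case True
        have "w (t + h) - w t \<le> g t * (exp h - 1)" "w t \<le> w (t + h)"
          using True assms increment_le[of t "t + h"] w_mono_pos[of t "t + h"] by simp_all
        moreover have "g t * (exp h - 1) \<le> ?G * (exp h - 1)"
          using True assms by (intro mult_right_mono g_antimono) auto
        ultimately have "\<bar>w (t + h) - w t\<bar> \<le> ?G * (exp h - 1)" by linarith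
        then show ?thesis using True by simp
      next
        case False
        have "w t - w (t + h) \<le> g (t + h) * (exp (- h) - 1)" "w (t + h) \<le> w t"
          using False elim assms increment_le[of "t + h" t] w_mono_pos[of "t + h" t] by simp_all
        moreover have "g (t + h) * (exp (- h) - 1) \<le> ?G * (exp (- h) - 1)"
          using False elim assms by (intro mult_right_mono g_antimono) auto
        ultimately have "\<bar>w (t + h) - w t\<bar> \<le> ?G * (exp (- h) - 1)" by linarith
        then show ?thesis using False by simp
      qed
    qed
    have "((\<lambda>h. ?G * \<bar>exp \<bar>h\<bar> - 1\<bar>) \<longlongrightarrow> ?G * \<bar>exp \<bar>0\<bar> - 1\<bar>) (at 0)"
      by (intro tendsto_intros)
    then show "((\<lambda>h. ?G * \<bar>exp \<bar>h\<bar> - 1\<bar>) \<longlongrightarrow> 0) (at 0)" by simp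
  qed
  then have "((\<lambda>h. w (t + h)) \<longlongrightarrow> w t) (at 0)" by (simp add: LIM_zero_iff)
  then show ?thesis by (simp add: isCont_iff)
qed

lemma w_tendsto_right: "0 \<le> t \<Longrightarrow> (w \<longlongrightarrow> w t) (at_right t)"
  using isCont_w[of t] w_right_continuous_0
  by (cases "t = 0") (auto simp: isCont_def intro: tendsto_within_subset)

lemma continuous_on_w: "continuous_on {0..} w"
proof -
  have "continuous (at t within {0..}) w" if "0 \<le> t" for t
  proof (cases "t = 0")
    case True
    then show ?thesis using w_right_continuous_0 by (simp add: continuous_within at_within_Ici_at_right)
  next
    case False
    then show ?thesis using isCont_w[of t] that by (simp add: continuous_at_imp_continuous_at_within)
  qed
  then show ?thesis by (simp add: continuous_on_eq_continuous_within)
qed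

lemma continuous_on_w_Icc: "0 \<le> a \<Longrightarrow> continuous_on {a..b} w"
  by (rule continuous_on_subset[OF continuous_on_w]) auto

text \<open>Improves the exponential factor of \<open>increment_le\<close> to a linear one by
  integrating the derivative of \<open>w\<close>, which exists off a countable set. Together with
  \<open>slope_ge\<close> this is the concavity of \<open>w\<close>.\<close>

lemma slope_le:
  assumes "0 < s" "s \<le> t" shows "w t - w s \<le> g s * (t - s)"
proof -
  have "g s * s - w s \<le> g s * t - w t"
  proof (rule nonneg_deriv_countable_exceptions[where \<Phi> = "\<lambda>x. g s * x - w x" and d = "\<lambda>x. g s - g x" and S = exceptions])
    show "((\<lambda>x. g s * x - w x) has_real_derivative g s - g x) (at x)" if "s < x" "x < t" "x \<notin> exceptions" for x
      using that assms by (auto intro!: derivative_eq_intros DERIV_w)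
    show "0 \<le> g s - g x" if "s < x" for x using that assms g_antimono[of s x] by simp
  qed (use assms countable_exceptions in \<open>auto intro!: continuous_intros continuous_on_w_Icc\<close>)
  then show ?thesis by (simp add: algebra_simps)
qed

lemma slope_ge:
  assumes "0 < s" "s \<le> t" shows "g t * (t - s) \<le> w t - w s"
proof -
  have "w s - g t * s \<le> w t - g t * t"
  proof (rule nonneg_deriv_countable_exceptions[where \<Phi> = "\<lambda>x. w x - g t * x" and d = "\<lambda>x. g x - g t" and S = exceptions])
    show "((\<lambda>x. w x - g t * x) has_real_derivative g x - g t) (at x)" if "s < x" "x < t" "x \<notin> exceptions" for x
      using that assms by (auto intro!: derivative_eq_intros DERIV_w)
    show "0 \<le> g x - g t" if "s < x" "x < t" for x using that assms g_antimono[of x t] by simp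
  qed (use assms countable_exceptions in \<open>auto intro!: continuous_intros continuous_on_w_Icc\<close>)
  then show ?thesis by (simp add: algebra_simps)
qed

lemma tangent: "0 < s \<Longrightarrow> 0 < t \<Longrightarrow> w t \<le> w s + g s * (t - s)"
  using slope_le[of s t] slope_ge[of t s] by (cases "s \<le> t") (auto simp: algebra_simps)

text \<open>The limit of \<open>slope_ge\<close> as the left point tends to \<open>0\<close>. Since
  \<open>w 0\<close> is nonnegative it gives \<open>g t * t \<le> w t\<close>, the source of the
  bound \<open>\<tau> \<le> 1\<close> for the reserve.\<close>

lemma w_0_le: "0 < t \<Longrightarrow> w 0 \<le> w t - g t * t"
proof -
  assume "0 < t"
  have "((\<lambda>s. w t - g t * (t - s)) \<longlongrightarrow> w t - g t * (t - 0)) (at_right 0)"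
    by (intro tendsto_intros)
  moreover have "eventually (\<lambda>s. w s \<le> w t - g t * (t - s)) (at_right 0)"
    unfolding eventually_at_right_field using slope_ge[of _ t] \<open>0 < t\<close>
    by (intro exI[of _ t]) (auto simp: algebra_simps)
  ultimately have "w 0 \<le> w t - g t * (t - 0)"
    using tendsto_le[OF _ _ w_right_continuous_0] by (simp add: trivial_limit_at_right_real)
  then show ?thesis by simp
qed

lemma w_pos: "0 < t \<Longrightarrow> 0 < w t"
  using w_0_le[of t] w_0_nonneg g_pos[of t] mult_pos_pos[of "g t" t] by linarith

lemma w_mono: "0 \<le> s \<Longrightarrow> s \<le> t \<Longrightarrow> w s \<le> w t"
  using w_mono_pos[of s t] w_0_le[of t] mult_pos_pos[OF g_pos, of t t]
  by (cases "s = 0"; cases "t = 0") auto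

lemma w_nonneg: "0 \<le> t \<Longrightarrow> 0 \<le> w t"
  using w_mono[of 0 t] w_0_nonneg by simp

text \<open>The ratio \<open>w t / t\<close> is nonincreasing since \<open>w\<close> is concave, and so is \<open>t / (exp t - 1)\<close> since
  \<open>exp\<close> is convex.\<close>

lemma w_ge_exponential:
  assumes "0 < t" "t \<le> \<tau>"
  shows "w \<tau> * (exp t - 1) \<le> w t * (exp \<tau> - 1)"
proof -
  have "g t * t \<le> w t" using w_0_le[OF assms(1)] w_0_nonneg by simp
  then have "g t * t * (\<tau> - t) \<le> w t * (\<tau> - t)" using assms by (intro mult_right_mono) auto
  moreover have "(w \<tau> - w t) * t \<le> g t * (\<tau> - t) * t"
    using slope_le[OF assms] assms by (intro mult_right_mono) auto
  ultimately have 1: "w \<tau> * t \<le> w t * \<tau>" by (simp add: algebra_simps)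
  have "exp ((1 - t / \<tau>) *\<^sub>R 0 + (t / \<tau>) *\<^sub>R \<tau>) \<le> (1 - t / \<tau>) * exp 0 + (t / \<tau>) * exp \<tau>"
    by (rule convex_onD[OF exp_convex]) (use assms in auto)
  then have "exp t - 1 \<le> t / \<tau> * (exp \<tau> - 1)" using assms by (simp add: algebra_simps)
  then have "w \<tau> * (exp t - 1) \<le> w \<tau> * (t / \<tau> * (exp \<tau> - 1))"
    using w_nonneg[of \<tau>] assms by (intro mult_left_mono) auto
  also have "\<dots> = w \<tau> * t * (exp \<tau> - 1) / \<tau>" by simp
  also have "\<dots> \<le> w t * \<tau> * (exp \<tau> - 1) / \<tau>"
    using 1 assms by (intro divide_right_mono mult_right_mono) auto
  also have "\<dots> = w t * (exp \<tau> - 1)" using assms by simp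
  finally show ?thesis .
qed

lemma reserve_exists:
  obtains \<tau> where "0 \<le> \<tau>" "\<tau> \<le> 1" "\<And>t. \<tau> < t \<Longrightarrow> g t \<le> w t" "\<And>t. 0 < t \<Longrightarrow> t < \<tau> \<Longrightarrow> w t < g t"
    "\<And>t. \<tau> < t \<Longrightarrow> g t \<le> w \<tau>"
proof -
  define T where "T = {t. 0 < t \<and> g t \<le> w t}"
  define \<tau> where "\<tau> = Inf T"
  \<comment> \<open>At \<open>t = 1\<close> the inequality \<open>g t * t \<le> w t\<close> reads
    \<open>g 1 \<le> w 1\<close>.\<close>
  have "1 \<in> T" using w_0_le[of 1] w_0_nonneg unfolding T_def by simp
  have bdd: "bdd_below T" by (auto simp: T_def intro!: bdd_belowI[of _ 0])
  have "0 \<le> \<tau>" unfolding \<tau>_def by (rule cInf_greatest) (use \<open>1 \<in> T\<close> in blast, simp add: T_def)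
  have "\<tau> \<le> 1" unfolding \<tau>_def using \<open>1 \<in> T\<close> bdd by (rule cInf_lower)
  have above: "g t \<le> w t" if "\<tau> < t" for t
  proof -
    have "T \<noteq> {}" using \<open>1 \<in> T\<close> by blast
    then have "\<exists>s\<in>T. s < t" by (rule cInf_lessD) (rule that[unfolded \<tau>_def])
    then obtain s where "s \<in> T" "s < t" by (elim bexE)
    then show ?thesis using g_antimono[of s t] w_mono_pos[of s t] by (simp add: T_def)
  qed
  have below: "w t < g t" if "0 < t" "t < \<tau>" for t
  proof (rule ccontr)
    assume "\<not> w t < g t"
    then have "t \<in> T" using that by (simp add: T_def)
    then have "\<tau> \<le> t" unfolding \<tau>_def using bdd by (rule cInf_lower)
    then show False using that by simp
  qed
  have "g t \<le> w \<tau>" if "\<tau> < t" for t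
  proof (rule tendsto_lowerbound[OF w_tendsto_right[OF \<open>0 \<le> \<tau>\<close>]])
    have "g t \<le> w s" if "\<tau> < s" "s < t" for s
      using above[of s] g_antimono[of s t] that \<open>0 \<le> \<tau>\<close> by simp
    then show "eventually (\<lambda>s. g t \<le> w s) (at_right \<tau>)"
      using that by (auto simp: eventually_at_right_field)
  qed simp
  then show thesis using \<open>0 \<le> \<tau>\<close> \<open>\<tau> \<le> 1\<close> above below by (intro that)
qed

end

section \<open>Revenue of the optimal auction in terms of the profile\<close>

context valuation_profile
begin

definition reserve :: "real \<Rightarrow> bool" where
  "reserve \<tau> \<longleftrightarrow> 0 \<le> \<tau> \<and> \<tau> \<le> 1 \<and> (\<forall>t>\<tau>. g t \<le> w t) \<and> (\<forall>t. 0 < t \<longrightarrow> t < \<tau> \<longrightarrow> w t < g t)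
    \<and> (\<forall>t>\<tau>. g t \<le> w \<tau>)"

lemma reserve_obtain: obtains \<tau> where "reserve \<tau>"
  using reserve_exists unfolding reserve_def by metis

text \<open>Replacing \<open>g\<close> by the constant \<open>w \<tau>\<close> up to the reserve \<open>\<tau>\<close> makes it antitone on all reals,
  hence Borel measurable, and bounded.\<close>

definition w_ext :: "real \<Rightarrow> real" where
  "w_ext t = w (max 0 t)"

definition g_ext :: "real \<Rightarrow> real \<Rightarrow> real" where
  "g_ext \<tau> t = (if t \<le> \<tau> then w \<tau> else g t)"

lemma w_ext_eq: "0 \<le> t \<Longrightarrow> w_ext t = w t"
  by (simp add: w_ext_def)

lemma continuous_on_w_ext: "continuous_on A w_ext"
  unfolding w_ext_def
  by (rule continuous_on_compose2[OF continuous_on_w]) (auto intro!: continuous_intros)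

lemma borel_w_ext [measurable]: "w_ext \<in> borel_measurable borel"
  by (intro borel_measurable_continuous_onI continuous_on_w_ext)

context
  fixes n :: nat and \<tau> :: real
  assumes n: "2 \<le> n" and res: "reserve \<tau>"
begin

lemma \<tau>_nonneg: "0 \<le> \<tau>"
  using res by (simp add: reserve_def)

lemma g_le_reserve: "\<tau> < t \<Longrightarrow> g t \<le> w \<tau>"
  using res by (simp add: reserve_def)

lemma borel_g_ext [measurable]: "g_ext \<tau> \<in> borel_measurable borel"
proof -
  have "- g_ext \<tau> s \<le> - g_ext \<tau> t" if "s \<le> t" for s t
    using that g_le_reserve[of t] g_antimono[of s t] \<tau>_nonneg by (auto simp: g_ext_def)
  then have "(\<lambda>t. - g_ext \<tau> t) \<in> borel_measurable borel"
    by (intro borel_measurable_mono monoI)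
  then have "(\<lambda>t. - (- g_ext \<tau> t)) \<in> borel_measurable borel"
    by (rule borel_measurable_uminus)
  then show ?thesis by simp
qed

lemma g_ext_bounds: "0 \<le> t \<Longrightarrow> 0 \<le> g_ext \<tau> t" "g_ext \<tau> t \<le> w \<tau>"
  using g_le_reserve[of t] g_pos[of t] w_nonneg[of \<tau>] \<tau>_nonneg by (auto simp: g_ext_def)

lemma g_ext_le_w: "\<tau> \<le> t \<Longrightarrow> g_ext \<tau> t \<le> w_ext t"
  using res \<tau>_nonneg by (auto simp: g_ext_def w_ext_def reserve_def)

lemma max_density_le: "0 \<le> t \<Longrightarrow> max_density n t \<le> real n"
proof -
  assume t: "0 \<le> t"
  have "exp (- t) * level t ^ (n - 1) \<le> 1"
    using t level_bounds[of t] by (intro mult_le_one power_le_one) auto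
  then have "real n * (exp (- t) * level t ^ (n - 1)) \<le> real n * 1" by (intro mult_left_mono) auto
  then show ?thesis by (simp add: max_density_def mult.assoc)
qed

lemma integrable_g_density: "(\<lambda>t. g_ext \<tau> t * max_density n t) integrable_on {\<tau>..b}"
proof (rule measurable_bounded_by_integrable_imp_integrable_real)
  have "(\<lambda>t. g_ext \<tau> t * max_density n t) \<in> borel_measurable borel" by measurable
  then show "(\<lambda>t. g_ext \<tau> t * max_density n t) \<in> borel_measurable (lebesgue_on {\<tau>..b})"
    by (intro measurable_restrict_space1 measurable_completion) simp
  show "(\<lambda>t. w \<tau> * real n) integrable_on {\<tau>..b}" by (rule integrable_const_ivl)
  show "\<bar>g_ext \<tau> t * max_density n t\<bar> \<le> w \<tau> * real n" if "t \<in> {\<tau>..b}" for t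
  proof -
    have "0 \<le> t" using that \<tau>_nonneg by simp
    then show ?thesis
      using g_ext_bounds[of t] max_density_le[of t] densities_nonneg[of t n] w_nonneg[OF \<tau>_nonneg]
      by (simp add: abs_mult mult_mono)
  qed
qed simp

lemma isCont_g_ext:
  assumes "\<tau> < t" "t \<notin> exceptions" shows "isCont (g_ext \<tau>) t"
proof -
  have "eventually (\<lambda>x. x \<in> {\<tau><..}) (nhds t)"
    using assms by (intro eventually_nhds_in_open) auto
  then have "eventually (\<lambda>x. g_ext \<tau> x = g x) (nhds t)"
    by eventually_elim (simp add: g_ext_def)
  moreover have "isCont g t" using assms \<tau>_nonneg by (auto simp: exceptions_def)
  ultimately show ?thesis by (simp add: isCont_cong)
qed

lemma DERIV_max_density:
  "(max_density n has_real_derivative second_density n t - max_density n t) (at t within A)"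
proof -
  obtain m where m: "n = Suc (Suc m)" using n by (metis add_2_eq_Suc le_Suc_ex)
  show ?thesis
    unfolding max_density_def[abs_def] second_density_def m
    by (rule derivative_eq_intros has_derivative_level refl)+ (simp add: algebra_simps power2_eq_square)
qed

lemma integrable_w_second: "0 \<le> a \<Longrightarrow> (\<lambda>t. w t * second_density n t) integrable_on {a..b}"
  by (intro integrable_continuous_real continuous_intros continuous_on_w_Icc)

text \<open>Since the derivative of \<open>max_density\<close> is
  \<open>second_density - max_density\<close>, integrating \<open>w * max_density\<close> by parts
  trades the virtual valuation against the highest bid for \<open>w\<close> against the second
  highest bid.\<close>

lemma revenue_integral:
  assumes "\<tau> \<le> b"
  shows "((\<lambda>t. (w_ext t - g_ext \<tau> t) * max_density n t) has_integral
    w \<tau> * max_density n \<tau> - w b * max_density n b + integral {\<tau>..b} (\<lambda>t. w t * second_density n t)) {\<tau>..b}"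
proof -
  \<comment> \<open>Off the jumps of \<open>g\<close> this is the derivative of
    \<open>- w * max_density\<close>; adding \<open>w * second_density\<close> gives the integrand
    of the claim.\<close>
  define p where "p t = w_ext t * (max_density n t - second_density n t) - g_ext \<tau> t * max_density n t" for t
  have "(p has_integral (- (w b * max_density n b)) - (- (w \<tau> * max_density n \<tau>))) {\<tau>..b}"
  proof (rule FTC_countable_exceptions[where \<Phi> = "\<lambda>t. - (w t * max_density n t)" and S = exceptions])
    show "continuous_on {\<tau>..b} (\<lambda>t. - (w t * max_density n t))"
      by (intro continuous_intros continuous_on_w_Icc \<tau>_nonneg)
    show "p integrable_on {\<tau>..b}"
      unfolding p_def
      by (intro integrable_diff integrable_g_density integrable_continuous_real continuous_intros continuous_on_w_ext)
    show "((\<lambda>t. - (w t * max_density n t)) has_real_derivative p t) (at t)" if "\<tau> < t" "t < b" "t \<notin> exceptions" for t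
      using that \<tau>_nonneg
      by (auto intro!: derivative_eq_intros DERIV_w DERIV_max_density simp: p_def w_ext_eq g_ext_def algebra_simps)
    show "isCont p t" if "\<tau> < t" "t < b" "t \<notin> exceptions" for t
    proof -
      have "isCont w_ext t" "isCont (max_density n) t" "isCont (second_density n) t"
        using continuous_on_w_ext[of UNIV] continuous_on_densities[of UNIV n]
        by (auto simp: continuous_on_eq_continuous_at)
      then show ?thesis unfolding p_def[abs_def] using isCont_g_ext that by (intro continuous_intros) auto
    qed
  qed (use assms countable_exceptions in auto)
  from has_integral_add[OF this integrable_integral[OF integrable_w_second[OF \<tau>_nonneg]]]
  have "((\<lambda>t. p t + w t * second_density n t) has_integral
    w \<tau> * max_density n \<tau> - w b * max_density n b + integral {\<tau>..b} (\<lambda>t. w t * second_density n t)) {\<tau>..b}"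
    by (simp add: algebra_simps)
  then show ?thesis
    by (rule has_integral_eq[rotated]) (use \<tau>_nonneg in \<open>auto simp: p_def w_ext_eq algebra_simps\<close>)
qed

text \<open>Beyond \<open>\<tau>\<close> all slopes are at most \<open>w \<tau>\<close>. The line is
  anchored at \<open>s > \<tau>\<close> first, because \<open>g \<tau>\<close> may exceed
  \<open>w \<tau>\<close>, and then \<open>s\<close> decreases to \<open>\<tau>\<close>.\<close>

lemma w_le_reserve_line:
  assumes "\<tau> \<le> t" shows "w t \<le> w \<tau> + w \<tau> * (t - \<tau>)"
proof (cases "\<tau> = t")
  case False
  have "w t \<le> w s + w \<tau> * (t - s)" if "\<tau> < s" "s < t" for s
  proof -
    have "w t - w s \<le> g s * (t - s)" using that \<tau>_nonneg by (intro slope_le) auto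
    also have "\<dots> \<le> w \<tau> * (t - s)" using that g_le_reserve by (intro mult_right_mono) auto
    finally show ?thesis by simp
  qed
  then have "eventually (\<lambda>s. w t \<le> w s + w \<tau> * (t - s)) (at_right \<tau>)"
    using False assms by (auto simp: eventually_at_right_field intro!: exI[of _ t])
  moreover have "((\<lambda>s. w s + w \<tau> * (t - s)) \<longlongrightarrow> w \<tau> + w \<tau> * (t - \<tau>)) (at_right \<tau>)"
    by (intro tendsto_intros w_tendsto_right \<tau>_nonneg)
  ultimately show ?thesis by (intro tendsto_lowerbound) auto
qed simp

text \<open>Integrates the line of \<open>w_le_reserve_line\<close> exactly, then replaces the
  values at \<open>b\<close> by their limits \<open>1\<close> and \<open>harm n - 1\<close>, which
  makes the bound independent of \<open>b\<close>.\<close>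

lemma second_integral_le_reserve:
  assumes "\<tau> \<le> b"
  shows "integral {\<tau>..b} (\<lambda>t. w t * second_density n t)
    \<le> w \<tau> * (1 - second_cdf n (level \<tau>) + (harm n - 1) - second_mean n (level \<tau>))"
proof -
  let ?r = "w \<tau>" and ?K = "\<lambda>t. second_cdf n (level t)" and ?B = "\<lambda>t. second_mean n (level t)"
  have "0 \<le> b" and r: "0 \<le> ?r" using assms \<tau>_nonneg w_nonneg by auto
  have "integral {\<tau>..b} (\<lambda>t. w t * second_density n t)
      \<le> ((?r - ?r * \<tau> + ?r * b) * ?K b - ?r * (b - ?B b)) - ((?r - ?r * \<tau> + ?r * \<tau>) * ?K \<tau> - ?r * (\<tau> - ?B \<tau>))"
  proof (rule has_integral_le[OF integrable_integral[OF integrable_w_second[OF \<tau>_nonneg]]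
        has_integral_affine_second_density[OF n assms]])
    fix t assume "t \<in> {\<tau>..b}"
    then show "w t * second_density n t \<le> (?r - ?r * \<tau> + ?r * t) * second_density n t"
      using w_le_reserve_line[of t] \<tau>_nonneg densities_nonneg[of t n]
      by (intro mult_right_mono) (auto simp: algebra_simps)
  qed
  also have "\<dots> = ?r * ((1 + (b - \<tau>)) * ?K b - (b - \<tau>) + ?B b - ?K \<tau> - ?B \<tau>)"
    by (simp add: algebra_simps)
  also have "\<dots> \<le> ?r * (1 - ?K \<tau> + (harm n - 1) - ?B \<tau>)"
  proof (rule mult_left_mono[OF _ r])
    have "(1 + (b - \<tau>)) * ?K b \<le> (1 + (b - \<tau>)) * 1"
      using second_cdf_le_1[OF n, of "level b"] level_bounds[of b] \<open>0 \<le> b\<close> assms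
      by (intro mult_left_mono) auto
    moreover have "?B b \<le> harm n - 1"
      using second_mean_le[OF n, of "level b"] level_bounds[of b] \<open>0 \<le> b\<close> by auto
    ultimately show "(1 + (b - \<tau>)) * ?K b - (b - \<tau>) + ?B b - ?K \<tau> - ?B \<tau> \<le> 1 - ?K \<tau> + (harm n - 1) - ?B \<tau>"
      by simp
  qed
  finally show ?thesis .
qed

lemma harm_gt_1: "1 < (harm n :: real)"
proof -
  have "(1::real) < harm 2" by (simp add: harm_expand)
  also have "\<dots> \<le> harm n" using n by (rule harm_mono)
  finally show ?thesis .
qed

text \<open>Jensen's inequality for the concave \<open>w\<close>, by its tangent at the mean \<open>harm n - 1\<close>.\<close>

lemma second_integral_le_mean:
  assumes "0 \<le> b"
  shows "integral {0..b} (\<lambda>t. w t * second_density n t) \<le> w (harm n - 1)"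
proof -
  define s where "s = harm n - (1::real)"
  have s: "0 < s" using harm_gt_1 by (simp add: s_def)
  let ?\<alpha> = "w s - g s * s" and ?\<beta> = "g s"
  let ?K = "\<lambda>t. second_cdf n (level t)" and ?B = "\<lambda>t. second_mean n (level t)"
  have a: "0 \<le> ?\<alpha>" using w_0_le[OF s] w_0_nonneg by linarith
  have be: "0 \<le> ?\<beta>" using g_pos[OF s] by simp
  have "integral {0..b} (\<lambda>t. w t * second_density n t)
      \<le> ((?\<alpha> + ?\<beta> * b) * ?K b - ?\<beta> * (b - ?B b)) - ((?\<alpha> + ?\<beta> * 0) * ?K 0 - ?\<beta> * (0 - ?B 0))"
  proof (rule has_integral_le[OF integrable_integral[OF integrable_w_second[OF order_refl]]
        has_integral_affine_second_density[OF n assms]])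
    fix t assume t: "t \<in> {0..b}"
    have "w t \<le> ?\<alpha> + ?\<beta> * t"
      using tangent[OF s, of t] w_0_le[OF s] t by (cases "t = 0") (auto simp: algebra_simps)
    then show "w t * second_density n t \<le> (?\<alpha> + ?\<beta> * t) * second_density n t"
      using densities_nonneg[of t n] t by (intro mult_right_mono) auto
  qed
  also have "\<dots> = (?\<alpha> + ?\<beta> * b) * ?K b - ?\<beta> * b + ?\<beta> * ?B b"
    using at_level_0(1)[OF n] at_level_0(2) by (simp add: level_def algebra_simps)
  also have "\<dots> \<le> (?\<alpha> + ?\<beta> * b) * 1 - ?\<beta> * b + ?\<beta> * s"
    using second_cdf_le_1[OF n, of "level b"] second_mean_le[OF n, of "level b"] level_bounds[of b] assms a be
    unfolding s_def[symmetric]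
    by (intro add_mono diff_right_mono mult_left_mono) auto
  finally show ?thesis by (simp add: s_def)
qed

text \<open>By \<open>w_ge_exponential\<close>, \<open>w t\<close> dominates a multiple of
  \<open>exp t - 1\<close>, and \<open>second_density * (exp t - 1)\<close> equals
  \<open>(n - 1) * max_density\<close>, whose integral is explicit. The constant \<open>c\<close>
  collects the resulting factors.\<close>

lemma second_integral_below_reserve:
  "real (n - 1) * w \<tau> * exp (- \<tau>) * level \<tau> ^ (n - 1) \<le> integral {0..\<tau>} (\<lambda>t. w t * second_density n t)"
proof (cases "\<tau> = 0")
  case True
  then show ?thesis using n by (simp add: level_def zero_power)
next
  case False
  then have \<tau>: "0 < \<tau>" using \<tau>_nonneg by simp
  define c where "c = real (n - 1) * w \<tau> / (exp \<tau> - 1)"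
  have "((\<lambda>t. c * max_density n t) has_integral c * (level \<tau> ^ n - level 0 ^ n)) {0..\<tau>}"
    using n \<tau> by (intro has_integral_mult_right has_integral_max_density) auto
  moreover have "((\<lambda>t. w t * second_density n t) has_integral integral {0..\<tau>} (\<lambda>t. w t * second_density n t)) {0..\<tau>}"
    by (intro integrable_integral integrable_w_second) simp
  moreover have "c * max_density n t \<le> w t * second_density n t" if "t \<in> {0..\<tau>}" for t
  proof (cases "t = 0")
    case True
    then show ?thesis using n w_0_nonneg densities_nonneg[of 0 n] by (simp add: max_density_def level_def zero_power)
  next
    case False
    then have t: "0 < t" "t \<le> \<tau>" using that by auto
    obtain m where m: "n = Suc (Suc m)" using n by (metis add_2_eq_Suc le_Suc_ex)
    have lev: "level t = exp (- t) * (exp t - 1)" by (simp add: level_def algebra_simps exp_minus)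
    have "max_density n t * real (n - 1) = second_density n t * (exp t - 1)"
      unfolding max_density_def second_density_def m by (simp add: lev power2_eq_square)
    then have "c * max_density n t = second_density n t * (w \<tau> * (exp t - 1)) / (exp \<tau> - 1)"
      by (simp add: c_def mult_ac)
    also have "\<dots> \<le> second_density n t * (w t * (exp \<tau> - 1)) / (exp \<tau> - 1)"
      using w_ge_exponential[OF t] \<tau> t densities_nonneg[of t n]
      by (intro divide_right_mono mult_left_mono) auto
    also have "\<dots> = w t * second_density n t" using \<tau> by simp
    finally show ?thesis .
  qed
  ultimately have "c * (level \<tau> ^ n - level 0 ^ n) \<le> integral {0..\<tau>} (\<lambda>t. w t * second_density n t)"
    by (rule has_integral_le)
  moreover have "c * (level \<tau> ^ n - level 0 ^ n) = real (n - 1) * w \<tau> * exp (- \<tau>) * level \<tau> ^ (n - 1)"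
  proof -
    have "level \<tau> ^ n = level \<tau> * level \<tau> ^ (n - 1)" "level 0 ^ n = 0"
      using n by (simp_all add: power_eq_if level_def)
    moreover have "level \<tau> = exp (- \<tau>) * (exp \<tau> - 1)" by (simp add: level_def algebra_simps exp_minus)
    moreover have "exp \<tau> - 1 \<noteq> 0" using \<tau> by simp
    ultimately show ?thesis unfolding c_def by (simp add: divide_simps)
  qed
  ultimately show ?thesis by simp
qed

text \<open>With \<open>q = exp (- \<tau>)\<close>, these are the two terms of
  \<open>U_objective\<close> before \<open>w \<tau>\<close> and \<open>w (harm n - 1)\<close> are
  compared with the pricing revenue.\<close>

definition revenue_bound :: real where
  "revenue_bound = min (w (harm n - 1) + w \<tau> * exp (- \<tau>) * level \<tau> ^ (n - 1))
    (w \<tau> * (\<Sum>j<n. (1 - (1 - exp (- \<tau>)) ^ Suc j) / real (Suc j)))"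

lemma revenue_integral_le:
  assumes "\<tau> \<le> b"
  shows "w \<tau> * max_density n \<tau> - w b * max_density n b + integral {\<tau>..b} (\<lambda>t. w t * second_density n t) \<le> revenue_bound"
proof -
  define S where "S = integral {\<tau>..b} (\<lambda>t. w t * second_density n t)"
  define r where "r = w \<tau>"
  define x where "x = exp (- \<tau>) * level \<tau> ^ (n - 1)"
  have "0 \<le> b" using assms \<tau>_nonneg by simp
  then have "0 \<le> w b * max_density n b" using w_nonneg densities_nonneg by simp
  moreover have "w \<tau> * max_density n \<tau> = real n * (r * x)" by (simp add: max_density_def r_def x_def)
  moreover have "S \<le> w (harm n - 1) - real (n - 1) * (r * x)"
  proof -
    have "integral {0..b} (\<lambda>t. w t * second_density n t) = integral {0..\<tau>} (\<lambda>t. w t * second_density n t) + S"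
      unfolding S_def using \<tau>_nonneg assms
      by (intro Henstock_Kurzweil_Integration.integral_combine[symmetric] integrable_w_second) auto
    then show ?thesis
      using second_integral_le_mean[OF \<open>0 \<le> b\<close>] second_integral_below_reserve by (simp add: r_def x_def mult.assoc)
  qed
  \<comment> \<open>Extending the integral down to \<open>0\<close> pays back \<open>n - 1\<close>
    of the \<open>n\<close> copies of \<open>r * x\<close> in the boundary term; a single copy
    survives.\<close>
  moreover have "real n * (r * x) - real (n - 1) * (r * x) = r * x"
    using n by (simp add: of_nat_diff algebra_simps)
  ultimately have 1: "w \<tau> * max_density n \<tau> - w b * max_density n b + S \<le> w (harm n - 1) + r * x"
    by linarith
  have "S \<le> r * (1 - second_cdf n (level \<tau>) + (harm n - 1) - second_mean n (level \<tau>))"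
    using second_integral_le_reserve[OF assms] by (simp add: S_def r_def)
  then have "real n * (r * x) + S
      \<le> r * (real n * x + 1 - second_cdf n (level \<tau>) + (harm n - 1) - second_mean n (level \<tau>))"
    by (simp add: algebra_simps)
  also have "real n * x = real n * exp (- \<tau>) * level \<tau> ^ (n - 1)" by (simp add: x_def)
  also note tail_kernel_identity[OF n exp_level[of \<tau>]]
  finally have "w \<tau> * max_density n \<tau> - w b * max_density n b + S
      \<le> w \<tau> * (\<Sum>j<n. (1 - (1 - exp (- \<tau>)) ^ Suc j) / real (Suc j))"
    using \<open>0 \<le> w b * max_density n b\<close> \<open>w \<tau> * max_density n \<tau> = real n * (r * x)\<close> unfolding r_def by linarith
  with 1 show ?thesis by (simp add: revenue_bound_def S_def r_def x_def mult.assoc)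
qed

text \<open>Only \<open>t > \<tau>\<close> contributes. The half-line is exhausted by bounded
  intervals, on which \<open>revenue_integral\<close> applies, and the bound is uniform in their
  length.\<close>

lemma revenue_nn_integral_le:
  "(\<integral>\<^sup>+t. ennreal (max 0 (w t - g t) * max_density n t) * indicator {0<..} t \<partial>lborel) \<le> ennreal revenue_bound"
proof -
  let ?p = "\<lambda>t. (w_ext t - g_ext \<tau> t) * max_density n t"
  have "(\<integral>\<^sup>+t. ennreal (max 0 (w t - g t) * max_density n t) * indicator {0<..} t \<partial>lborel)
      \<le> (\<integral>\<^sup>+t. (SUP k. ennreal (?p t) * indicator {\<tau>..\<tau> + real k} t) \<partial>lborel)"
  proof (rule nn_integral_mono_AE)
    \<comment> \<open>At \<open>\<tau>\<close> the sign of \<open>w - g\<close> is not determined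
      and \<open>g_ext\<close> may differ from \<open>g\<close>; one point is negligible.\<close>
    have "AE t in lborel. t \<noteq> \<tau>" by (rule AE_lborel_singleton)
    then show "AE t in lborel. ennreal (max 0 (w t - g t) * max_density n t) * indicator {0<..} t
        \<le> (SUP k. ennreal (?p t) * indicator {\<tau>..\<tau> + real k} t)"
    proof (rule AE_mp, intro AE_I2 impI)
      fix t assume "t \<noteq> \<tau>"
      show "ennreal (max 0 (w t - g t) * max_density n t) * indicator {0<..} t
          \<le> (SUP k. ennreal (?p t) * indicator {\<tau>..\<tau> + real k} t)"
      proof (cases "\<tau> < t")
        case True
        obtain k where "t - \<tau> \<le> real k" using real_arch_simple by blast
        have "max 0 (w t - g t) = w_ext t - g_ext \<tau> t"
          using True res \<tau>_nonneg by (auto simp: reserve_def w_ext_eq g_ext_def)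
        then have "ennreal (max 0 (w t - g t) * max_density n t) * indicator {0<..} t
            = ennreal (?p t) * indicator {\<tau>..\<tau> + real k} t"
          using True \<tau>_nonneg \<open>t - \<tau> \<le> real k\<close> by (auto simp: indicator_def)
        also have "\<dots> \<le> (SUP k. ennreal (?p t) * indicator {\<tau>..\<tau> + real k} t)" by (rule SUP_upper) simp
        finally show ?thesis .
      next
        case False
        then have "t < \<tau>" using \<open>t \<noteq> \<tau>\<close> by simp
        then have "0 < t \<Longrightarrow> max 0 (w t - g t) = 0" using res by (auto simp: reserve_def less_imp_le)
        then show ?thesis by (cases "0 < t") (auto simp: indicator_def)
      qed
    qed
  qed
  also have "\<dots> = (SUP k. \<integral>\<^sup>+t. ennreal (?p t) * indicator {\<tau>..\<tau> + real k} t \<partial>lborel)"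
  proof (rule nn_integral_monotone_convergence_SUP)
    show "incseq (\<lambda>k t. ennreal (?p t) * indicator {\<tau>..\<tau> + real k} t)"
      by (auto simp: incseq_def le_fun_def indicator_def)
  qed measurable
  also have "\<dots> \<le> ennreal revenue_bound"
  proof (rule SUP_least)
    fix k
    let ?I = "w \<tau> * max_density n \<tau> - w (\<tau> + real k) * max_density n (\<tau> + real k)
      + integral {\<tau>..\<tau> + real k} (\<lambda>t. w t * second_density n t)"
    have "(\<integral>\<^sup>+t. ennreal (?p t) * indicator {\<tau>..\<tau> + real k} t \<partial>lborel) = ennreal ?I"
    proof (rule nn_integral_has_integral_lebesgue'[OF _ revenue_integral])
      show "0 \<le> ?p t" if "t \<in> {\<tau>..\<tau> + real k}" for t
        using that g_ext_le_w[of t] densities_nonneg[of t n] \<tau>_nonneg by simp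
    qed simp
    also have "\<dots> \<le> ennreal revenue_bound" by (intro ennreal_leI revenue_integral_le) simp
    finally show "(\<integral>\<^sup>+t. ennreal (?p t) * indicator {\<tau>..\<tau> + real k} t \<partial>lborel) \<le> ennreal revenue_bound" .
  qed
  finally show ?thesis .
qed

end

end

section \<open>MHR distributions\<close>

locale mhr_distribution =
  fixes F f :: "real \<Rightarrow> real" and D :: "real set"
  assumes continuous_distribution: "continuous_distribution F f D" and MHR: "MHR F f D"
begin

abbreviation M :: "real measure" where "M \<equiv> distr_of_pdf f"

lemma borel_pdf [measurable]: "f \<in> borel_measurable borel"
  and pdf_nonneg: "0 \<le> f x"
  and prob_space_M: "prob_space M"
  and F_eq: "F = cdf M"
  and interval_D: "is_interval D"
  and D_nonneg: "x \<in> D \<Longrightarrow> 0 \<le> x"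
  and AE_in_D: "AE x in M. x \<in> D"
  using continuous_distribution unfolding continuous_distribution_def by auto

sublocale M: real_distribution M
  using prob_space_M by (auto simp: real_distribution_def real_distribution_axioms_def)

lemma F_mono: "x \<le> y \<Longrightarrow> F x \<le> F y"
  unfolding F_eq by (rule M.cdf_nondecreasing)

lemma F_nonneg: "0 \<le> F x" and F_le_1: "F x \<le> 1"
  unfolding F_eq by (rule M.cdf_nonneg, rule M.cdf_bounded_prob)

lemma AE_neq: "AE x in M. x \<noteq> a"
  using AE_lborel_singleton[of a] by (auto simp: AE_density elim: AE_mp)

lemma F_eq_0I: "AE x in M. \<not> x \<le> a \<Longrightarrow> F a = 0"
  unfolding F_eq cdf_def by (subst M.prob_eq_0) auto

lemma F_eq_1I: "AE x in M. x \<le> a \<Longrightarrow> F a = 1"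
  unfolding F_eq cdf_def by (subst M.prob_eq_1) auto

lemma isCont_F: "isCont F a"
proof -
  have "emeasure M {a} = 0"
    using AE_neq[of a] by (subst (asm) AE_iff_measurable[where N = "{a}"]) auto
  then show ?thesis unfolding F_eq M.isCont_cdf by (simp add: measure_def)
qed

lemma continuous_on_F: "continuous_on A F"
  by (intro continuous_at_imp_continuous_on ballI isCont_F)

lemma F_0: "x \<le> 0 \<Longrightarrow> F x = 0"
proof -
  have "F 0 = 0"
    by (rule F_eq_0I) (use AE_in_D AE_neq[of 0] in \<open>eventually_elim, use D_nonneg in force\<close>)
  then show "x \<le> 0 \<Longrightarrow> F x = 0" using F_mono[of x 0] F_nonneg[of x] by simp
qed

text \<open>A point outside the interval \<open>D\<close> has all of \<open>D\<close> on one side,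
  so the cdf there is \<open>0\<close> or \<open>1\<close>.\<close>

lemma in_D:
  assumes "0 < F x" "F x < 1" shows "x \<in> D"
proof (rule ccontr)
  assume "x \<notin> D"
  show False
  proof (cases "\<exists>y\<in>D. x < y")
    case True
    then have "x < z" if "z \<in> D" for z
      using \<open>x \<notin> D\<close> that mem_is_interval_1_I[OF interval_D, of z] by (metis linorder_le_cases linorder_not_le order_le_less)
    then have "F x = 0"
      by (intro F_eq_0I) (use AE_in_D in \<open>eventually_elim, force\<close>)
    then show False using assms by simp
  next
    case False
    then have "F x = 1"
      by (intro F_eq_1I) (use AE_in_D in \<open>eventually_elim, force\<close>)
    then show False using assms by simp
  qed
qed

lemma hazard_mono:
  assumes "0 < F a" "a \<le> b" "F b < 1"
  shows "f a / (1 - F a) \<le> f b / (1 - F b)"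
proof -
  have "F a \<le> F b" using assms(2) by (rule F_mono)
  then have "a \<in> D" "b \<in> D" "F a < 1" using assms in_D[of a] in_D[of b] by auto
  then show ?thesis
    using MHR assms unfolding MHR_def by (auto elim!: mono_onD)
qed

text \<open>A zero of the pdf at \<open>a\<close> is a zero of the hazard rate, so monotonicity
  makes the pdf vanish on \<open>D\<close> up to \<open>a\<close>, and no mass is left below
  \<open>a\<close>.\<close>

lemma pdf_pos:
  assumes "0 < F a" "F a < 1" shows "0 < f a"
proof (rule ccontr)
  assume "\<not> 0 < f a"
  then have "f a = 0" using pdf_nonneg[of a] by simp
  have "f x = 0" if "x \<in> D" "x \<le> a" for x
  proof -
    have "F x < 1" using F_mono[OF that(2)] assms by simp
    moreover have "a \<in> D" using assms by (rule in_D)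
    ultimately have "f x / (1 - F x) \<le> f a / (1 - F a)"
      using MHR assms that unfolding MHR_def by (auto elim!: mono_onD)
    then show ?thesis using \<open>f a = 0\<close> \<open>F x < 1\<close> pdf_nonneg[of x] by (simp add: divide_le_0_iff)
  qed
  moreover have "AE x in M. 0 < f x"
    by (simp add: AE_density)
  ultimately have "AE x in M. \<not> x \<le> a"
    using AE_in_D by (metis (mono_tags, lifting) AE_mp AE_I2 less_irrefl)
  then have "F a = 0" by (rule F_eq_0I)
  then show False using assms by simp
qed

lemma emeasure_Ioc: "a \<le> b \<Longrightarrow> (\<integral>\<^sup>+x. ennreal (f x) * indicator {a<..b} x \<partial>lborel) = ennreal (F b - F a)"
  using M.emeasure_Ioc[of a b] unfolding F_eq by (subst (asm) emeasure_density) auto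

lemma F_increment_le:
  assumes "a \<le> b" "0 \<le> c" "\<And>x. a < x \<Longrightarrow> x \<le> b \<Longrightarrow> f x \<le> c"
  shows "F b - F a \<le> c * (b - a)"
proof -
  have "ennreal (F b - F a) \<le> (\<integral>\<^sup>+x. ennreal c * indicator {a<..b} x \<partial>lborel)"
    unfolding emeasure_Ioc[OF assms(1), symmetric]
    by (rule nn_integral_mono) (use assms in \<open>auto simp: indicator_def intro: ennreal_leI\<close>)
  also have "\<dots> = ennreal (c * (b - a))"
    using assms by (simp add: nn_integral_cmult_indicator ennreal_mult)
  finally show ?thesis using assms by (simp add: ennreal_le_iff)
qed

lemma F_increment_ge:
  assumes "a \<le> b" "0 \<le> c" "\<And>x. a < x \<Longrightarrow> x \<le> b \<Longrightarrow> c \<le> f x"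
  shows "c * (b - a) \<le> F b - F a"
proof -
  have "ennreal (c * (b - a)) = (\<integral>\<^sup>+x. ennreal c * indicator {a<..b} x \<partial>lborel)"
    using assms by (simp add: nn_integral_cmult_indicator ennreal_mult)
  also have "\<dots> \<le> ennreal (F b - F a)"
    unfolding emeasure_Ioc[OF assms(1), symmetric]
    by (rule nn_integral_mono) (use assms in \<open>auto simp: indicator_def intro: ennreal_leI\<close>)
  finally show ?thesis using assms F_mono[of a b] by (simp add: ennreal_le_iff)
qed

text \<open>The largest quantile is taken: at \<open>t = 0\<close> the quantiles are unbounded
  below, and the supremum selects the largest \<open>x\<close> with \<open>F x = 0\<close>, which
  makes \<open>w\<close> right-continuous at \<open>0\<close>.\<close>

definition w :: "real \<Rightarrow> real" where
  "w t = Sup {x. F x \<le> level t}"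

definition g :: "real \<Rightarrow> real" where
  "g t = (1 - F (w t)) / f (w t)"

lemma
  assumes "0 \<le> t"
  shows le_w: "F x \<le> level t \<Longrightarrow> x \<le> w t" and F_w: "F (w t) = level t"
proof -
  let ?A = "{x. F x \<le> level t}"
  have "eventually (\<lambda>x. level t < F x) at_top"
    using M.cdf_lim_at_top_prob level_bounds(2) unfolding F_eq by (rule order_tendstoD)
  then obtain X where X: "level t < F X" by (auto simp: eventually_at_top_linorder)
  have "x \<le> X" if "x \<in> ?A" for x using that X F_mono[of X x] by (cases "x \<le> X") auto
  then have bdd: "bdd_above ?A" by (rule bdd_aboveI)
  have "closed ?A" using continuous_on_F[of UNIV] by (intro closed_Collect_le) auto
  have "0 \<in> ?A" using F_0[of 0] level_bounds(1)[OF assms] by simp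
  then have "?A \<noteq> {}" by blast
  have "w t \<in> ?A" unfolding w_def by (rule closed_contains_Sup[OF \<open>?A \<noteq> {}\<close> bdd \<open>closed ?A\<close>])
  show le: "x \<le> w t" if "F x \<le> level t" for x
    unfolding w_def using that bdd by (intro cSup_upper) auto
  have "0 \<le> X" using X F_0[of X] level_bounds(1)[OF assms] by (cases "0 \<le> X") auto
  then obtain y where "F y = level t"
    using IVT'[of F 0 "level t" X] F_0[of 0] X level_bounds(1)[OF assms] continuous_on_F by force
  then have "level t \<le> F (w t)" using F_mono[OF le[of y]] by simp
  then show "F (w t) = level t" using \<open>w t \<in> ?A\<close> by simp
qed

lemma survival_w: "0 \<le> t \<Longrightarrow> 1 - F (w t) = exp (- t)"
  by (simp add: F_w level_def)

lemma F_w_interior: "0 < t \<Longrightarrow> 0 < F (w t)" "0 < t \<Longrightarrow> F (w t) < 1"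
  using level_bounds[of t] by (simp_all add: F_w)

lemma level_mono: "s \<le> t \<Longrightarrow> level s \<le> level t"
  by (simp add: level_def)

lemma w_mono': "0 \<le> s \<Longrightarrow> s \<le> t \<Longrightarrow> w s \<le> w t"
  by (intro le_w) (auto simp: F_w level_mono)

lemma g_eq: "0 < t \<Longrightarrow> g t = exp (- t) / f (w t)"
  by (simp add: g_def survival_w)

lemma pdf_le_of_hazard:
  assumes "0 < F a" "a \<le> b" "F b < 1"
  shows "f a \<le> f b / (1 - F b) * (1 - F a)" "f a / (1 - F a) * (1 - F b) \<le> f b"
  using hazard_mono[OF assms] F_mono[OF assms(2)] assms(3) by (simp_all add: field_simps)

text \<open>Between \<open>w s\<close> and \<open>w t\<close> the hazard rate lies between its end
  values, and the survival probability between \<open>exp (- t)\<close> and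
  \<open>exp (- s)\<close>. Their product bounds the pdf by constants, and the exponential factors
  in the increment axioms come from these survival probabilities.\<close>

sublocale valuation_profile w g
proof
  fix t :: real assume t: "0 < t"
  show "0 < g t" unfolding g_eq[OF t] using pdf_pos F_w_interior t by simp
next
  fix s t :: real assume "0 < s" "s \<le> t"
  then have t: "0 < t" by simp
  have "f (w s) / exp (- s) \<le> f (w t) / exp (- t)"
    using hazard_mono[of "w s" "w t"] w_mono'[of s t] F_w_interior[of s] F_w_interior[of t] survival_w[of s] survival_w[of t]
      \<open>0 < s\<close> \<open>s \<le> t\<close> by simp
  then show "g t \<le> g s"
    unfolding g_eq[OF \<open>0 < s\<close>] g_eq[OF t] using pdf_pos F_w_interior \<open>0 < s\<close> t by (simp add: field_simps)
next
  show "0 \<le> w 0" by (rule le_w) (simp_all add: F_0 level_def)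
next
  show "(w \<longlongrightarrow> w 0) (at_right 0)"
  proof (rule order_tendstoI)
    fix c assume "c < w 0"
    have "eventually (\<lambda>t::real. 0 < t) (at_right 0)" by (rule eventually_at_right_less)
    then show "eventually (\<lambda>t. c < w t) (at_right 0)"
      by eventually_elim (rule order_less_le_trans[OF \<open>c < w 0\<close> w_mono'], auto)
  next
    fix c assume "w 0 < c"
    \<comment> \<open>As \<open>w 0\<close> is the largest zero of \<open>F\<close>, the cdf is
      positive at \<open>c\<close>, so small levels are reached before \<open>c\<close>.\<close>
    then have "0 < F c" using le_w[of 0 c] by (force simp: level_def)
    moreover have lim: "(level \<longlongrightarrow> level 0) (at_right 0)"
      unfolding level_def[abs_def] by (intro tendsto_intros)
    ultimately have "eventually (\<lambda>t. level t < F c) (at_right 0)"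
      by (intro order_tendstoD(2)[OF lim]) (simp add: level_def)
    moreover have "eventually (\<lambda>t::real. 0 < t) (at_right 0)" by (rule eventually_at_right_less)
    ultimately show "eventually (\<lambda>t. w t < c) (at_right 0)"
    proof eventually_elim
      case (elim t)
      then show ?case using F_mono[of c "w t"] F_w[of t] by (cases "w t < c") auto
    qed
  qed
next
  fix s t :: real assume s: "0 < s" and st: "s \<le> t"
  then have t: "0 < t" by simp
  have ab: "w s \<le> w t" using s st by (intro w_mono') auto
  have F_diff: "F (w t) - F (w s) = exp (- s) - exp (- t)" using s t by (simp add: F_w level_def)
  have "F (w t) - F (w s) \<le> f (w t) / exp (- t) * exp (- s) * (w t - w s)"
  proof (rule F_increment_le[OF ab])
    fix x assume x: "w s < x" "x \<le> w t"
    have "0 < F x" using F_w_interior(1)[OF s] F_mono[of "w s" x] x by simp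
    then have "f x \<le> f (w t) / (1 - F (w t)) * (1 - F x)"
      using x F_w_interior[OF t] by (intro pdf_le_of_hazard)
    also have "\<dots> \<le> f (w t) / (1 - F (w t)) * (1 - F (w s))"
      using F_mono[of "w s" x] x F_w_interior[OF t] pdf_nonneg by (intro mult_left_mono) auto
    finally show "f x \<le> f (w t) / exp (- t) * exp (- s)" using s t by (simp add: survival_w)
  qed (use pdf_nonneg in simp)
  then have "(1 - exp (- (t - s))) * exp (- s) \<le> f (w t) / exp (- t) * (w t - w s) * exp (- s)"
    unfolding F_diff by (simp add: algebra_simps exp_add[symmetric])
  then have "1 - exp (- (t - s)) \<le> f (w t) / exp (- t) * (w t - w s)"
    by (rule mult_right_le_imp_le) simp
  then show "g t * (1 - exp (- (t - s))) \<le> w t - w s"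
    unfolding g_eq[OF t] using pdf_pos[OF F_w_interior(1)[OF t] F_w_interior(2)[OF t]] by (simp add: field_simps)
  have "f (w s) / exp (- s) * exp (- t) * (w t - w s) \<le> F (w t) - F (w s)"
  proof (rule F_increment_ge[OF ab])
    fix x assume x: "w s < x" "x \<le> w t"
    have "F x < 1" using F_w_interior(2)[OF t] F_mono[of x "w t"] x by simp
    have "f (w s) / (1 - F (w s)) * (1 - F (w t)) \<le> f (w s) / (1 - F (w s)) * (1 - F x)"
      using F_mono[of x "w t"] x F_w_interior[OF s] pdf_nonneg by (intro mult_left_mono) auto
    also have "\<dots> \<le> f x"
      using x F_w_interior[OF s] \<open>F x < 1\<close> by (intro pdf_le_of_hazard) auto
    finally show "f (w s) / exp (- s) * exp (- t) \<le> f x" using s t by (simp add: survival_w)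
  qed (use pdf_nonneg in simp)
  then have "f (w s) / exp (- s) * (w t - w s) * exp (- t) \<le> (exp (t - s) - 1) * exp (- t)"
    unfolding F_diff by (simp add: algebra_simps exp_add[symmetric])
  then have "f (w s) / exp (- s) * (w t - w s) \<le> exp (t - s) - 1"
    by (rule mult_right_le_imp_le) simp
  then show "w t - w s \<le> g s * (exp (t - s) - 1)"
    unfolding g_eq[OF s] using pdf_pos[OF F_w_interior(1)[OF s] F_w_interior(2)[OF s]] by (simp add: field_simps)
qed

end

section \<open>Law of the highest valuation\<close>

definition max_exponential :: "nat \<Rightarrow> real measure" where
  "max_exponential n = density lborel (\<lambda>t. ennreal (max_density n t) * indicator {0..} t)"

lemma level_tendsto: "(level \<longlongrightarrow> 1) at_top"
proof -
  have "((\<lambda>t::real. 1 - exp (- t)) \<longlongrightarrow> 1 - 0) at_top"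
    by (intro tendsto_intros filterlim_compose[OF exp_at_bot] filterlim_uminus_at_bot_at_top)
  then show ?thesis by (simp add: level_def[abs_def])
qed

lemma real_distribution_max_exponential:
  assumes "0 < n" shows "real_distribution (max_exponential n)"
proof -
  have "(\<integral>\<^sup>+t. ennreal (max_density n t) * indicator {0..} t \<partial>lborel) = ennreal (1 ^ n - level 0 ^ n)"
    by (rule nn_integral_FTC_atLeast[OF _ DERIV_level_power])
      (use assms densities_nonneg tendsto_power[OF level_tendsto, of n] in auto)
  also have "\<dots> = 1" using assms by (simp add: level_def zero_power)
  finally have "prob_space (max_exponential n)"
    unfolding max_exponential_def by (intro prob_spaceI) (simp add: emeasure_density)
  then show ?thesis
    by (simp add: real_distribution_def real_distribution_axioms_def max_exponential_def)
qed

lemma cdf_max_exponential: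
  assumes "0 < n" "0 \<le> T" shows "cdf (max_exponential n) T = level T ^ n"
proof -
  have "emeasure (max_exponential n) {..T} = (\<integral>\<^sup>+t. ennreal (max_density n t) * indicator {0..T} t \<partial>lborel)"
    unfolding max_exponential_def
    by (subst emeasure_density) (auto intro!: nn_integral_cong simp: indicator_def)
  also have "\<dots> = ennreal (level T ^ n - level 0 ^ n)"
    by (rule nn_integral_has_integral_lebesgue'[OF _ has_integral_max_density])
      (use assms densities_nonneg in auto)
  also have "\<dots> = ennreal (level T ^ n)" using assms by (simp add: level_def zero_power)
  finally show ?thesis
    using level_bounds(1)[OF assms(2)] by (simp add: cdf_def measure_def)
qed

lemma AE_max_exponential: "(AE t in lborel. 0 < t \<longrightarrow> P t) \<Longrightarrow> AE t in max_exponential n. P t"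
proof -
  assume "AE t in lborel. 0 < t \<longrightarrow> P t"
  moreover have "AE t in lborel. t \<noteq> (0::real)" by (rule AE_lborel_singleton)
  ultimately show ?thesis
    unfolding max_exponential_def by (subst AE_density) (auto simp: indicator_def split: if_splits)
qed

context mhr_distribution
begin

lemma cdf_max_valuation:
  assumes "0 < n"
  shows "cdf (distr (Pi\<^sub>M {..<n} (\<lambda>_. M)) borel (max_valuation n)) x = F x ^ n"
proof -
  interpret P: product_prob_space "\<lambda>_. M" "{..<n}"
    by unfold_locales
  have [measurable]: "max_valuation n \<in> borel_measurable (Pi\<^sub>M {..<n} (\<lambda>_. M))"
    unfolding max_valuation_def by measurable
  have "max_valuation n v \<le> x \<longleftrightarrow> (\<forall>i<n. v i \<le> x)" for v
    unfolding max_valuation_def using assms by (subst Max_le_iff) (auto simp: lessThan_empty_iff)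
  then have "max_valuation n -` {..x} \<inter> space (Pi\<^sub>M {..<n} (\<lambda>_. M))
      = {v \<in> space (Pi\<^sub>M {..<n} (\<lambda>_. M)). \<forall>i\<in>{..<n}. v i \<in> {..x}}"
    by auto
  then have "emeasure (distr (Pi\<^sub>M {..<n} (\<lambda>_. M)) borel (max_valuation n)) {..x} = (\<Prod>i<n. emeasure M {..x})"
    using P.emeasure_PiM_Collect[of "{..<n}" "\<lambda>_. {..x}"] by (simp add: emeasure_distr)
  also have "\<dots> = ennreal (F x ^ n)"
    unfolding F_eq cdf_def M.emeasure_eq_measure by (simp add: ennreal_power)
  finally show ?thesis using F_nonneg[of x] by (simp add: cdf_def measure_def)
qed

lemma cdf_distr_w_ext:
  assumes "0 < n"
  shows "cdf (distr (max_exponential n) borel w_ext) x = F x ^ n"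
proof -
  interpret N: real_distribution "max_exponential n"
    using assms by (rule real_distribution_max_exponential)
  have "cdf (distr (max_exponential n) borel w_ext) x = measure (max_exponential n) {t. w_ext t \<le> x}"
    unfolding cdf_def by (subst measure_distr) (auto simp: vimage_def)
  also have "\<dots> = F x ^ n"
  proof (cases "F x < 1")
    case True
    define T where "T = - ln (1 - F x)"
    have T: "0 \<le> T" "level T = F x" using True F_nonneg[of x] by (simp_all add: T_def level_def)
    \<comment> \<open>The two events agree because \<open>F (w t) = level t\<close>; they may differ
      at \<open>t = T\<close>, where \<open>w T\<close> can exceed \<open>x\<close>.\<close>
    have "AE t in max_exponential n. t \<in> {t. w_ext t \<le> x} \<longleftrightarrow> t \<in> {..T}"
    proof (rule AE_max_exponential)
      have "AE t in lborel. t \<noteq> T" by (rule AE_lborel_singleton)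
      then show "AE t in lborel. 0 < t \<longrightarrow> t \<in> {t. w_ext t \<le> x} \<longleftrightarrow> t \<in> {..T}"
      proof eventually_elim
        case (elim t)
        show ?case
        proof (cases "t < T")
          case True
          then have "level t < F x" using T(2) by (simp add: level_def flip: T(2))
          then have "w t \<le> x" if "0 < t" using F_mono[of x "w t"] F_w[of t] that by (cases "w t \<le> x") auto
          then show ?thesis using True by (simp add: w_ext_eq)
        next
          case False
          then have "F x < level t" using elim by (simp add: level_def flip: T(2))
          then have "\<not> w t \<le> x" if "0 < t" using F_mono[of "w t" x] F_w[of t] that by auto
          then show ?thesis using False elim by (simp add: w_ext_eq)
        qed
      qed
    qed
    then have "measure (max_exponential n) {t. w_ext t \<le> x} = measure (max_exponential n) {..T}"
      by (intro N.finite_measure_eq_AE) auto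
    then show ?thesis
      using cdf_max_exponential[OF assms T(1)] T(2) by (simp add: cdf_def)
  next
    case False
    then have "F x = 1" using F_le_1[of x] by simp
    have "w t \<le> x" if "0 < t" for t
      using F_mono[of x "w t"] F_w_interior(2)[OF that] \<open>F x = 1\<close> by (cases "w t \<le> x") auto
    then have "AE t in max_exponential n. w_ext t \<le> x"
      by (intro AE_max_exponential) (simp add: w_ext_eq)
    then have "measure (max_exponential n) {t. w_ext t \<le> x} = 1"
      by (subst N.prob_eq_1) auto
    then show ?thesis using \<open>F x = 1\<close> by simp
  qed
  finally show ?thesis .
qed

text \<open>Both laws have cdf \<open>F x ^ n\<close>, so the product space can be replaced by a
  single exponential maximum transported by \<open>w\<close>.\<close>

lemma distr_max_valuation:
  assumes "0 < n"
  shows "distr (Pi\<^sub>M {..<n} (\<lambda>_. M)) borel (max_valuation n) = distr (max_exponential n) borel w_ext"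
proof (rule cdf_unique)
  interpret P: product_prob_space "\<lambda>_. M" "{..<n}"
    by unfold_locales
  have "max_valuation n \<in> borel_measurable (Pi\<^sub>M {..<n} (\<lambda>_. M))"
    unfolding max_valuation_def by measurable
  then show "real_distribution (distr (Pi\<^sub>M {..<n} (\<lambda>_. M)) borel (max_valuation n))"
    by (rule P.P.real_distribution_distr)
  interpret N: real_distribution "max_exponential n"
    using assms by (rule real_distribution_max_exponential)
  show "real_distribution (distr (max_exponential n) borel w_ext)"
    by (rule N.real_distribution_distr) simp
  show "cdf (distr (Pi\<^sub>M {..<n} (\<lambda>_. M)) borel (max_valuation n)) = cdf (distr (max_exponential n) borel w_ext)"
    using cdf_max_valuation[OF assms] cdf_distr_w_ext[OF assms] by auto
qed

lemma borel_F [measurable]: "F \<in> borel_measurable borel"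
  using F_mono by (intro borel_measurable_mono monoI)

text \<open>After the change of variable the virtual valuation at \<open>w t\<close> is
  \<open>w t - g t\<close> for \<open>t > 0\<close>, so \<open>revenue_nn_integral_le\<close>
  applies.\<close>

lemma Myerson_le:
  assumes n: "2 \<le> n" and res: "reserve \<tau>"
  shows "Myerson F f n \<le> revenue_bound n \<tau>"
proof -
  let ?P = "Pi\<^sub>M {..<n} (\<lambda>_. M)" and ?\<phi> = "virtual_valuation F f"
  have n0: "0 < n" using n by simp
  have [measurable]: "max_valuation n \<in> borel_measurable ?P"
    unfolding max_valuation_def by measurable
  have [measurable]: "?\<phi> \<in> borel_measurable borel"
    unfolding virtual_valuation_def[abs_def] by measurable
  interpret N: real_distribution "max_exponential n"
    using n0 by (rule real_distribution_max_exponential)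
  have "(\<integral>\<^sup>+v. ennreal (max 0 (?\<phi> (max_valuation n v))) \<partial>?P)
      = (\<integral>\<^sup>+x. ennreal (max 0 (?\<phi> x)) \<partial>distr ?P borel (max_valuation n))"
    by (subst nn_integral_distr) auto
  also have "\<dots> = (\<integral>\<^sup>+t. ennreal (max 0 (?\<phi> (w_ext t))) \<partial>max_exponential n)"
    unfolding distr_max_valuation[OF n0] by (subst nn_integral_distr) auto
  also have "\<dots> = (\<integral>\<^sup>+t. ennreal (max_density n t) * indicator {0..} t * ennreal (max 0 (?\<phi> (w_ext t))) \<partial>lborel)"
    unfolding max_exponential_def by (subst nn_integral_density) auto
  also have "\<dots> = (\<integral>\<^sup>+t. ennreal (max 0 (w t - g t) * max_density n t) * indicator {0<..} t \<partial>lborel)"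
  proof (rule nn_integral_cong_AE)
    have "AE t in lborel. t \<noteq> (0::real)" by (rule AE_lborel_singleton)
    then show "AE t in lborel. ennreal (max_density n t) * indicator {0..} t * ennreal (max 0 (?\<phi> (w_ext t)))
        = ennreal (max 0 (w t - g t) * max_density n t) * indicator {0<..} t"
    proof eventually_elim
      case (elim t)
      then show ?case
        using densities_nonneg[of t n]
        by (cases "0 < t") (auto simp: indicator_def w_ext_eq virtual_valuation_def g_def ennreal_mult mult.commute)
    qed
  qed
  also have "\<dots> \<le> ennreal (revenue_bound n \<tau>)"
    by (rule revenue_nn_integral_le[OF n res])
  finally have "(\<integral>\<^sup>+v. ennreal (max 0 (?\<phi> (max_valuation n v))) \<partial>?P) \<le> ennreal (revenue_bound n \<tau>)" .
  \<comment> \<open>A negative bound would be truncated to \<open>0\<close> by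
    \<open>ennreal\<close>, so its sign matters when returning to the real integral.\<close>
  moreover have "0 \<le> revenue_bound n \<tau>"
  proof -
    have \<tau>: "0 \<le> \<tau>" using res by (simp add: reserve_def)
    have "(1 - exp (- \<tau>)) ^ Suc j \<le> 1" for j
      using \<tau> by (intro power_le_one) auto
    then show ?thesis
      unfolding revenue_bound_def[OF n res] using w_nonneg[OF \<tau>] w_nonneg[of "harm n - 1"] harm_gt_1[OF n res] level_bounds(1)[OF \<tau>]
      by (auto intro!: mult_nonneg_nonneg add_nonneg_nonneg sum_nonneg divide_nonneg_pos)
  qed
  ultimately show ?thesis
    unfolding Myerson_def by (intro integral_real_bounded)
qed

section \<open>Lower bounds for the pricing revenue\<close>

lemma one_minus_F_power_le: "1 - F p ^ n \<le> real n * (1 - F p)"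
proof -
  have "1 + real n * (F p - 1) \<le> (1 + (F p - 1)) ^ n"
    using F_nonneg[of p] by (intro Bernoulli_inequality) auto
  then show ?thesis by (simp add: algebra_simps)
qed

text \<open>In terms of \<open>T = - ln (1 - F p)\<close> the price grows at most linearly by
  concavity, while the sale probability is at most \<open>n * exp (- T)\<close>. Boundedness is what
  lets a posted price bound the supremum from below.\<close>

lemma revenue_bdd_above:
  "bdd_above ((\<lambda>p. p * (1 - F p ^ n)) ` D)"
proof (rule bdd_aboveI2)
  fix p assume "p \<in> D"
  then have p: "0 \<le> p" by (rule D_nonneg)
  have g1: "0 < g 1" and w1: "0 < w 1" using g_pos w_pos by auto
  show "p * (1 - F p ^ n) \<le> real n * (w 1 + g 1)"
  proof (cases "F p < 1")
    case True
    define T where "T = - ln (1 - F p)"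
    have T: "0 \<le> T" "level T = F p" using True F_nonneg[of p] by (simp_all add: T_def level_def)
    have "p \<le> w T" using T by (intro le_w) auto
    also have "w T \<le> w 1 + g 1 * T"
      using tangent[of 1 T] w_mono[of 0 1] T g1 by (cases "T = 0") (auto simp: algebra_simps)
    finally have "p * (1 - F p ^ n) \<le> (w 1 + g 1 * T) * (real n * (1 - F p))"
      using p one_minus_F_power_le[of p n] power_le_one[OF F_nonneg F_le_1, of p n] T g1 w1
      by (intro mult_mono) auto
    also have "1 - F p = exp (- T)" by (simp add: T(2)[symmetric] level_def)
    also have "(w 1 + g 1 * T) * (real n * exp (- T)) = real n * (w 1 * exp (- T) + g 1 * (T * exp (- T)))"
      by (simp add: algebra_simps)
    also have "\<dots> \<le> real n * (w 1 * 1 + g 1 * 1)"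
    proof (intro mult_left_mono add_mono)
      have "T \<le> exp T" using exp_ge_add_one_self[of T] by linarith
      then show "T * exp (- T) \<le> 1" by (simp add: exp_minus field_simps)
    qed (use T g1 w1 in auto)
    finally show ?thesis by simp
  next
    case False
    then have "F p = 1" using F_le_1[of p] by simp
    then show ?thesis using g1 w1 by simp
  qed
qed

lemma Price_ge_interior:
  assumes "0 < t" shows "w t * (1 - level t ^ n) \<le> Price F D n"
proof -
  have "w t \<in> D" using assms by (intro in_D F_w_interior)
  then have "w t * (1 - F (w t) ^ n) \<le> Price F D n"
    unfolding Price_def using revenue_bdd_above by (intro cSUP_upper)
  then show ?thesis using F_w[of t] assms by simp
qed

text \<open>For \<open>t = 0\<close> the price \<open>w 0\<close> may be an endpoint missing from
  \<open>D\<close>; it is approached by admissible prices from the right.\<close>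

lemma Price_ge:
  assumes "0 \<le> t" shows "w t * (1 - level t ^ n) \<le> Price F D n"
proof (rule tendsto_upperbound)
  have "(level \<longlongrightarrow> level t) (at_right t)"
    unfolding level_def[abs_def] by (intro tendsto_intros)
  then show "((\<lambda>s. w s * (1 - level s ^ n)) \<longlongrightarrow> w t * (1 - level t ^ n)) (at_right t)"
    by (intro tendsto_intros w_tendsto_right assms)
  show "eventually (\<lambda>s. w s * (1 - level s ^ n) \<le> Price F D n) (at_right t)"
    using eventually_at_right_less[of t] by eventually_elim (use assms in \<open>auto intro: Price_ge_interior\<close>)
qed simp

lemma Price_pos: "0 < n \<Longrightarrow> 0 < Price F D n"
proof -
  assume "0 < n"
  then have "level 1 ^ n < 1" using level_bounds[of 1] by (simp add: power_less_one_iff)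
  then have "0 < w 1 * (1 - level 1 ^ n)" using w_pos[of 1] by simp
  also have "\<dots> \<le> Price F D n" by (rule Price_ge) simp
  finally show ?thesis .
qed

theorem APX_le_U:
  assumes n: "2 \<le> n" shows "APX F f D n \<le> U n"
proof -
  obtain \<tau> where res: "reserve \<tau>" by (rule reserve_obtain)
  then have \<tau>: "0 \<le> \<tau>" "\<tau> \<le> 1" by (simp_all add: reserve_def)
  define q where "q = exp (- \<tau>)"
  have q: "1 / exp 1 \<le> q" "q \<le> 1" "0 < q" "level \<tau> = 1 - q"
    using \<tau> by (simp_all add: q_def level_def exp_minus[symmetric] inverse_eq_divide[symmetric])
  define P where "P = Price F D n"
  have P: "0 < P" unfolding P_def using n by (intro Price_pos) simp
  define d where "d = 1 - (1 - q) ^ n"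
  define e where "e = 1 - (1 - exp (- harm n + 1 :: real)) ^ n"
  have d: "0 < d" unfolding d_def using q n by (intro one_minus_power_pos) auto
  have s: "0 < harm n - (1::real)" using harm_gt_1[OF n res] by simp
  have e: "0 < e" unfolding e_def using s n by (intro one_minus_power_pos) auto
  \<comment> \<open>The posted prices \<open>w \<tau>\<close> and, below,
    \<open>w (harm n - 1)\<close> sell with probabilities \<open>d\<close> and \<open>e\<close>;
    each bounds a value of \<open>w\<close> by a multiple of \<open>P\<close>.\<close>
  have "w \<tau> * d \<le> P"
    using Price_ge[OF \<tau>(1), of n] q by (simp add: P_def d_def)
  then have r: "w \<tau> \<le> P / d" using d by (simp add: pos_le_divide_eq)
  have "w (harm n - 1) * e \<le> P"
    using Price_ge[of "harm n - 1" n] s by (simp add: P_def e_def level_def)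
  then have m: "w (harm n - 1) \<le> P / e" using e by (simp add: pos_le_divide_eq)
  have M: "Myerson F f n \<le> revenue_bound n \<tau>" using n res by (rule Myerson_le)
  have "revenue_bound n \<tau> \<le> w (harm n - 1) + w \<tau> * (q * (1 - q) ^ (n - 1))"
    unfolding revenue_bound_def[OF n res] q(4) q_def[symmetric] by (simp add: mult.assoc)
  also have "\<dots> \<le> P / e + P / d * (q * (1 - q) ^ (n - 1))"
    using m r q by (intro add_mono mult_right_mono) auto
  also have "\<dots> = first_bound n q * P"
    by (simp add: first_bound_def d_def e_def algebra_simps)
  finally have 1: "Myerson F f n \<le> first_bound n q * P" using M by simp
  have "(1 - q) ^ Suc j \<le> 1" for j using q by (intro power_le_one) auto
  then have "0 \<le> (\<Sum>j<n. (1 - (1 - q) ^ Suc j) / real (Suc j))"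
    by (intro sum_nonneg divide_nonneg_pos) auto
  then have "w \<tau> * (\<Sum>j<n. (1 - (1 - q) ^ Suc j) / real (Suc j)) \<le> P / d * (\<Sum>j<n. (1 - (1 - q) ^ Suc j) / real (Suc j))"
    using r by (intro mult_right_mono)
  moreover have "revenue_bound n \<tau> \<le> w \<tau> * (\<Sum>j<n. (1 - (1 - q) ^ Suc j) / real (Suc j))"
    unfolding revenue_bound_def[OF n res] q_def[symmetric] by simp
  ultimately have "Myerson F f n \<le> P / d * (\<Sum>j<n. (1 - (1 - q) ^ Suc j) / real (Suc j))"
    using M by linarith
  also have "\<dots> = second_bound n q * P" by (simp add: second_bound_def d_def)
  finally have 2: "Myerson F f n \<le> second_bound n q * P" .
  have "APX F f D n \<le> U_objective n q"
    using 1 2 P q by (simp add: APX_def P_def[symmetric] U_objective_eq pos_divide_le_eq min_def)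
  also have "\<dots> \<le> U n" using U_attained[of n] n q by (metis pos2 order_less_le_trans)
  finally show ?thesis .
qed

end

theorem theorem4p2:
  shows "(\<forall>n\<ge>2. \<forall>F f D. continuous_distribution F f D \<and> MHR F f D \<longrightarrow> APX F f D n \<le> U n)
       \<and> (\<forall>n\<ge>2. U n \<le> U 3) \<and> U 3 \<le> 1.354
       \<and> (\<forall>F f D. continuous_distribution F f D \<and> MHR F f D \<longrightarrow> APX F f D 3 \<le> 1.354)"
proof -
  have APX: "APX F f D n \<le> U n" if "2 \<le> n" "continuous_distribution F f D" "MHR F f D" for n F f D
    using mhr_distribution.APX_le_U[of F f D n] that by (simp add: mhr_distribution_def)
  moreover have U3: "U 3 \<le> 1.354" using U_3_le by simp
  moreover have "APX F f D 3 \<le> 1.354" if "continuous_distribution F f D" "MHR F f D" for F f D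
    using APX[OF _ that, of 3] U3 by simp
  ultimately show ?thesis using U_le_U_3 by blast
qed

end
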